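(* Let $\alpha\in(0,1)$, $k_\alpha>0$, let $q=q(\rho)$ be the density function of a random variable $\rho$ taking values in $(0,1)$ almost surely, and let $\mathcal D_x^{\alpha,q(\rho)}$ be the convolution operator $$\mathcal D_x^{\alpha,q(\rho)}f(x)=\int_0^x\frac{d}{dz}f(z)\left(\int_0^1\frac{\Gamma(\rho;k_\alpha(x-z))}{\Gamma(\rho)}q(\rho)\,d\rho\right)dz .$$ Then the solution to the equation $$\frac{\partial}{\partial t}f(x,t)=-\mathcal D_x^{\alpha,q(\rho)}f(x,t)+e^{-t-k_\alpha x}\int_0^1\frac{k_\alpha^\rho x^{\rho-1}}{\Gamma(\rho)}q(\rho)\,d\rho,\qquad x\ge0,\ t\ge0,$$ with initial condition $f(x,0)=0$, is given by the density of the absolutely continuous component of the compound Poisson process $\mathcal S_\psi(t)=\sum_{j=1}^{N(t)}X_j^\psi$, where the $X_j^\psi$, $j=1,2,\dots$, are independent and identically distributed random variables with density $f_{X_j^\psi}(x)=e^{-k_\alpha x}\int_0^1\frac{k_\alpha^\rho x^{\rho-1}}{\Gamma(\rho)}q(\rho)\,d\rho$, $x\ge0$.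
   Context: $\Gamma(\rho;x):=\int_x^{+\infty}e^{-w}w^{\rho-1}\,dw$ is the upper-incomplete gamma function. The operator $\mathcal D_x^{\alpha,q(\rho)}$ is defined for $x>0$, for differentiable functions $f$ in $AC_{loc}(0,+\infty)$; applied to $f(x,t)$ it acts on the variable $x$. The constant $k_\alpha$ depends on $\alpha$ (e.g. $k_\alpha=\alpha/(1-\alpha)$). Compound Poisson process: in $\mathcal S_\psi(t)=\sum_{j=1}^{N(t)}X_j^\psi$, $t\ge0$, $N(t)$ is a Poisson process with parameter $1$ and the $X_j^\psi$ are non-negative i.i.d. random variables independent of $N$. Its distribution function is $P\{\mathcal S_\psi(t)<y\}=e^{-t}1_{[0,+\infty)}(y)+\int_{-\infty}^y f_{\mathcal S_\psi}(x,t)\,dx$, and $f_{\mathcal S_\psi}(\cdot,t)$ is called the density of the absolutely continuous component of $\mathcal S_\psi$; it equals $e^{-t}\sum_{n\ge1}\frac{t^n}{n!}f_{X^\psi}^{*(n)}(x)$, with $f^{*(n)}$ the $n$-fold convolution.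
   Formalization: The integral defining D diverges at z=0 for the claimed f, so D f(x) is read as the limit as ε→0+ of f(ε)K(x−ε)+∫_ε^x f'(z)K(x−z)dz, K the kernel; the equation is taken for x>0; uniqueness is among functions jointly locally integrable up to x=0. *)

theory Defs
  imports "HOL-Probability.Probability"
begin

section \<open>The convolution operator\<close>

definition upper_Gamma :: "real \<Rightarrow> real \<Rightarrow> real" where
  "upper_Gamma \<rho> x = (LBINT w:{x..}. exp (- w) * w powr (\<rho> - 1))"

definition conv_kernel :: "real \<Rightarrow> (real \<Rightarrow> real) \<Rightarrow> real \<Rightarrow> real" where
  "conv_kernel \<kappa> q y = (LBINT \<rho>:{0<..<1}. upper_Gamma \<rho> (\<kappa> * y) / Gamma \<rho> * q \<rho>)"

text \<open>The mixture of Gamma densities of shape \<open>\<rho>\<close> and rate \<open>\<kappa>\<close>. It is the density of the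
  jumps (extended by zero to the negative half-line), and, up to the factor \<open>exp (- t)\<close>,
  the forcing term of the equation.\<close>

definition jump_density :: "real \<Rightarrow> (real \<Rightarrow> real) \<Rightarrow> real \<Rightarrow> real" where
  "jump_density \<kappa> q x = indicator {0..} x * (exp (- \<kappa> * x) *
     (LBINT \<rho>:{0<..<1}. \<kappa> powr \<rho> * x powr (\<rho> - 1) / Gamma \<rho> * q \<rho>))"

text \<open>The plain Lebesgue integral defining the operator.\<close>

definition conv_deriv_integral ::
    "real \<Rightarrow> (real \<Rightarrow> real) \<Rightarrow> (real \<Rightarrow> real) \<Rightarrow> real \<Rightarrow> real" where
  "conv_deriv_integral \<kappa> q f x = (LBINT z:{0<..x}. deriv f z * conv_kernel \<kappa> q (x - z))"

text \<open>The jump density tends to infinity at \<open>0\<close> (all shapes are below \<open>1\<close>), hence so does the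
  density of the compound Poisson process, and its derivative is not integrable at \<open>0\<close>:
  the plain integral above diverges on the very function the operator is to be applied to.
  The derivative therefore has to be read as that of a function vanishing on the negative
  half-line. Truncating \<open>f\<close> to \<open>{\<epsilon>..}\<close>, its derivative consists of \<open>deriv f\<close> on
  \<open>{\<epsilon><..}\<close> and a point mass \<open>f \<epsilon>\<close> at \<open>\<epsilon>\<close>; the operator is the limit of the convolutions of
  these with the kernel as \<open>\<epsilon>\<close> tends to \<open>0\<close>. Lemma \<open>conv_deriv_eq_integral\<close> below shows
  that this is the plain integral whenever the latter converges and \<open>f\<close> vanishes at \<open>0\<close>.\<close>

definition conv_deriv_trunc ::
    "real \<Rightarrow> (real \<Rightarrow> real) \<Rightarrow> (real \<Rightarrow> real) \<Rightarrow> real \<Rightarrow> real \<Rightarrow> real" where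
  "conv_deriv_trunc \<kappa> q f x \<epsilon> =
     f \<epsilon> * conv_kernel \<kappa> q (x - \<epsilon>) + (LBINT z:{\<epsilon>..x}. deriv f z * conv_kernel \<kappa> q (x - z))"

definition conv_deriv_exists ::
    "real \<Rightarrow> (real \<Rightarrow> real) \<Rightarrow> (real \<Rightarrow> real) \<Rightarrow> real \<Rightarrow> bool" where
  "conv_deriv_exists \<kappa> q f x \<longleftrightarrow> (\<exists>d. (conv_deriv_trunc \<kappa> q f x \<longlongrightarrow> d) (at_right 0))"

definition conv_deriv :: "real \<Rightarrow> (real \<Rightarrow> real) \<Rightarrow> (real \<Rightarrow> real) \<Rightarrow> real \<Rightarrow> real" where
  "conv_deriv \<kappa> q f x = Lim (at_right 0) (conv_deriv_trunc \<kappa> q f x)"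

lemma Gamma_set_integral:
  fixes \<rho> :: real
  assumes "0 < \<rho>"
  shows "set_integrable lborel {0..} (\<lambda>w. exp (- w) * w powr (\<rho> - 1))"
    and "(LBINT w:{0..}. exp (- w) * w powr (\<rho> - 1)) = Gamma \<rho>"
proof -
  let ?f = "\<lambda>w::real. indicator {0..} w * w powr (\<rho> - 1) / exp w"
  have *: "indicat_real {0..} w *\<^sub>R (exp (- w) * w powr (\<rho> - 1)) = ?f w" for w
    by (simp add: exp_minus field_simps)
  have nn: "(\<integral>\<^sup>+w. ennreal (?f w) \<partial>lborel) = ennreal (Gamma \<rho>)"
    using Gamma_conv_nn_integral_real[OF assms] by simp
  have meas: "?f \<in> borel_measurable lborel"
    by measurable
  have int: "integrable lborel ?f"
    by (intro integrableI_nn_integral_finite[OF meas _ nn]) auto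
  then show "set_integrable lborel {0..} (\<lambda>w. exp (- w) * w powr (\<rho> - 1))"
    unfolding set_integrable_def * .
  have "integral\<^sup>L lborel ?f = Gamma \<rho>"
    using nn assms by (subst integral_eq_nn_integral[OF meas]) (auto simp: Gamma_real_pos less_imp_le)
  then show "(LBINT w:{0..}. exp (- w) * w powr (\<rho> - 1)) = Gamma \<rho>"
    unfolding set_lebesgue_integral_def * .
qed

lemma upper_Gamma_bounds:
  assumes "0 < \<rho>" and "0 \<le> x"
  shows "0 \<le> upper_Gamma \<rho> x" and "upper_Gamma \<rho> x \<le> Gamma \<rho>"
proof -
  show "0 \<le> upper_Gamma \<rho> x"
    unfolding upper_Gamma_def set_lebesgue_integral_def by (intro Bochner_Integration.integral_nonneg) auto
  show "upper_Gamma \<rho> x \<le> Gamma \<rho>"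
    unfolding upper_Gamma_def Gamma_set_integral(2)[OF assms(1), symmetric]
      set_lebesgue_integral_def
    using Gamma_set_integral(1)[OF assms(1)] assms(2)
    by (intro integral_mono') (auto simp: set_integrable_def indicator_def)
qed

lemma conv_kernel_bounds:
  assumes "0 < \<kappa>" and "0 \<le> y" and "\<And>r. 0 \<le> q r" and "set_integrable lborel {0<..<1} q"
  shows "0 \<le> conv_kernel \<kappa> q y" and "conv_kernel \<kappa> q y \<le> (LBINT r:{0<..<1}. q r)"
proof -
  have b: "0 \<le> upper_Gamma r (\<kappa> * y) / Gamma r" "upper_Gamma r (\<kappa> * y) / Gamma r \<le> 1"
    if "r \<in> {0<..<1}" for r
    using upper_Gamma_bounds[of r "\<kappa> * y"] Gamma_real_pos[of r] that assms(1,2)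
    by (auto simp: field_simps)
  show "0 \<le> conv_kernel \<kappa> q y"
    unfolding conv_kernel_def set_lebesgue_integral_def
    by (rule Bochner_Integration.integral_nonneg) (use b assms(3) in \<open>simp add: indicator_def del: times_divide_eq_left\<close>)
  show "conv_kernel \<kappa> q y \<le> (LBINT r:{0<..<1}. q r)"
    unfolding conv_kernel_def set_lebesgue_integral_def
  proof (rule integral_mono')
    show "integrable lborel (\<lambda>r. indicat_real {0<..<1} r *\<^sub>R q r)"
      using assms(4) by (simp add: set_integrable_def)
    show "indicat_real {0<..<1} r *\<^sub>R (upper_Gamma r (\<kappa> * y) / Gamma r * q r)
        \<le> indicat_real {0<..<1} r *\<^sub>R q r" for r
      using b[of r] assms(3)[of r] mult_right_mono[of "upper_Gamma r (\<kappa> * y) / Gamma r" 1 "q r"]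
      by (auto simp: indicator_def)
  qed (use assms(3) in auto)
qed

lemma upper_Gamma_measurable [measurable]:
  "case_prod upper_Gamma \<in> borel_measurable borel"
proof -
  have "(\<lambda>p. upper_Gamma (fst p) (snd p)) \<in> borel_measurable (borel \<Otimes>\<^sub>M borel)"
  proof -
    have "(\<lambda>p. \<integral>w. (if snd p \<le> w then exp (- w) * w powr (fst p - 1) else 0) \<partial>lborel)
        \<in> borel_measurable (borel \<Otimes>\<^sub>M borel :: (real \<times> real) measure)"
      by measurable
    moreover have "upper_Gamma r x = (\<integral>w. (if x \<le> w then exp (- w) * w powr (r - 1) else 0) \<partial>lborel)"
      for r x
      unfolding upper_Gamma_def set_lebesgue_integral_def
      by (intro Bochner_Integration.integral_cong) (auto simp: indicator_def)
    ultimately show ?thesis by simp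
  qed
  then show ?thesis
    by (simp add: borel_prod case_prod_beta')
qed

lemma conv_kernel_measurable:
  assumes "q \<in> borel_measurable borel"
  shows "conv_kernel \<kappa> q \<in> borel_measurable borel"
proof -
  note [measurable] = assms
  have [measurable]: "case_prod upper_Gamma \<in> borel_measurable (borel \<Otimes>\<^sub>M borel)"
    using upper_Gamma_measurable by (simp add: borel_prod)
  have "conv_kernel \<kappa> q =
      (\<lambda>y. LBINT r:{0<..<1}. upper_Gamma r (\<kappa> * y) / upper_Gamma r 0 * q r)"
    unfolding conv_kernel_def
    by (intro ext set_lebesgue_integral_cong)
      (auto simp: upper_Gamma_def[of _ 0] Gamma_set_integral(2))
  also have "\<dots> \<in> borel_measurable borel"
    unfolding set_lebesgue_integral_def by measurable
  finally show ?thesis .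
qed

lemma conv_deriv_eq_integral:
  assumes "0 < \<kappa>" and "0 < x"
    and q: "q \<in> borel_measurable borel" "\<And>r. 0 \<le> q r" "set_integrable lborel {0<..<1} q"
    and f: "(f \<longlongrightarrow> 0) (at_right 0)" "set_integrable lborel {0<..x} (deriv f)"
  shows "conv_deriv_exists \<kappa> q f x" and "conv_deriv \<kappa> q f x = conv_deriv_integral \<kappa> q f x"
proof -
  define C where "C = (LBINT r:{0<..<1}. q r)"
  have K: "\<bar>conv_kernel \<kappa> q y\<bar> \<le> C" if "0 \<le> y" for y
    using conv_kernel_bounds[OF assms(1) that q(2,3)] by (simp add: C_def)
  have [measurable]: "conv_kernel \<kappa> q \<in> borel_measurable borel"
    by (rule conv_kernel_measurable[OF q(1)])
  have int: "set_integrable lborel {0<..x} (\<lambda>z. deriv f z * conv_kernel \<kappa> q (x - z))"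
  proof -
    have fint: "integrable lborel (\<lambda>z. indicat_real {0<..x} z * deriv f z)"
      using f(2) by (simp add: set_integrable_def)
    note [measurable] = borel_measurable_integrable[OF fint]
    have "integrable lborel (\<lambda>z. C * (indicat_real {0<..x} z * deriv f z))"
      using fint by (rule integrable_mult_right)
    then have "integrable lborel
        (\<lambda>z. (indicat_real {0<..x} z * deriv f z) * conv_kernel \<kappa> q (x - z))"
    proof (rule Bochner_Integration.integrable_bound)
      show "(\<lambda>z. (indicat_real {0<..x} z * deriv f z) * conv_kernel \<kappa> q (x - z))
          \<in> borel_measurable lborel"
        by measurable
      have "\<bar>indicat_real {0<..x} z * deriv f z\<bar> * \<bar>conv_kernel \<kappa> q (x - z)\<bar>
          \<le> \<bar>indicat_real {0<..x} z * deriv f z\<bar> * \<bar>C\<bar>" for z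
        using K[of "x - z"] by (cases "z \<in> {0<..x}") (auto intro!: mult_left_mono)
      then show "AE z in lborel.
          norm ((indicat_real {0<..x} z * deriv f z) * conv_kernel \<kappa> q (x - z))
          \<le> norm (C * (indicat_real {0<..x} z * deriv f z))"
        by (simp add: abs_mult mult_ac)
    qed
    then show ?thesis
      by (simp add: set_integrable_def mult.assoc)
  qed
  have "((\<lambda>\<epsilon>. LBINT z:{\<epsilon>..x}. deriv f z * conv_kernel \<kappa> q (x - z))
      \<longlongrightarrow> conv_deriv_integral \<kappa> q f x) (at_right 0)"
    unfolding conv_deriv_integral_def
    using assms(2) int by (intro tendsto_set_lebesgue_integral_at_right) auto
  moreover have "((\<lambda>\<epsilon>. f \<epsilon> * conv_kernel \<kappa> q (x - \<epsilon>)) \<longlongrightarrow> 0) (at_right 0)"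
  proof (rule Lim_null_comparison)
    show "((\<lambda>\<epsilon>. \<bar>f \<epsilon>\<bar> * C) \<longlongrightarrow> 0) (at_right 0)"
      using f(1) by (intro tendsto_mult_left_zero tendsto_rabs_zero)
    have "eventually (\<lambda>\<epsilon>. \<epsilon> \<in> {0<..<x}) (at_right 0)"
      using assms(2) by (rule eventually_at_right_real)
    then show "eventually (\<lambda>\<epsilon>. norm (f \<epsilon> * conv_kernel \<kappa> q (x - \<epsilon>)) \<le> \<bar>f \<epsilon>\<bar> * C) (at_right 0)"
      by eventually_elim (auto simp: abs_mult intro!: mult_left_mono K)
  qed
  ultimately have lim: "(conv_deriv_trunc \<kappa> q f x \<longlongrightarrow> conv_deriv_integral \<kappa> q f x) (at_right 0)"
    unfolding conv_deriv_trunc_def by (auto dest: tendsto_add)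
  then show "conv_deriv_exists \<kappa> q f x"
    by (auto simp: conv_deriv_exists_def)
  show "conv_deriv \<kappa> q f x = conv_deriv_integral \<kappa> q f x"
    unfolding conv_deriv_def using lim by (intro tendsto_Lim) auto
qed

definition abs_continuous_on_interval :: "real \<Rightarrow> real \<Rightarrow> (real \<Rightarrow> real) \<Rightarrow> bool" where
  "abs_continuous_on_interval a b f \<longleftrightarrow>
     (\<forall>e>0. \<exists>d>0. \<forall>(n::nat) u v.
        (\<forall>i<n. a \<le> u i \<and> u i \<le> v i \<and> v i \<le> b) \<longrightarrow>
        disjoint_family_on (\<lambda>i. {u i<..<v i}) {..<n} \<longrightarrow>
        (\<Sum>i<n. v i - u i) < d \<longrightarrow> (\<Sum>i<n. \<bar>f (v i) - f (u i)\<bar>) < e)"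

definition AC_loc_pos :: "(real \<Rightarrow> real) \<Rightarrow> bool" where
  "AC_loc_pos f \<longleftrightarrow> (\<forall>a b. 0 < a \<longrightarrow> a < b \<longrightarrow> abs_continuous_on_interval a b f)"


section \<open>Solutions of the equation\<close>

text \<open>The equation is required for \<open>x > 0\<close>, since its right-hand side is meaningless at
  \<open>x = 0\<close>; at \<open>t = 0\<close> the time derivative is one-sided. Local integrability up to
  \<open>x = 0\<close> fixes the class of functions in which the solution is sought.\<close>

definition is_solution :: "real \<Rightarrow> (real \<Rightarrow> real) \<Rightarrow> (real \<Rightarrow> real \<Rightarrow> real) \<Rightarrow> bool" where
  "is_solution \<kappa> q f \<longleftrightarrow>
     (\<forall>R>0. \<forall>T>0. set_integrable (lborel :: (real \<times> real) measure) ({0<..R} \<times> {0..T})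
        (\<lambda>(x, t). f x t)) \<and>
     (\<forall>t\<ge>0. (\<lambda>x. f x t) differentiable_on {0<..} \<and> AC_loc_pos (\<lambda>x. f x t)) \<and>
     (\<forall>x\<ge>0. f x 0 = 0) \<and>
     (\<forall>x>0. \<forall>t\<ge>0. conv_deriv_exists \<kappa> q (\<lambda>z. f z t) x \<and>
        ((\<lambda>s. f x s) has_real_derivative
           (- conv_deriv \<kappa> q (\<lambda>z. f z t) x +
            exp (- t - \<kappa> * x) *
              (LBINT \<rho>:{0<..<1}. \<kappa> powr \<rho> * x powr (\<rho> - 1) / Gamma \<rho> * q \<rho>)))
        (at t within {0..}))"


section \<open>The compound Poisson process\<close>

text \<open>The subtraction of natural numbers is harmless because almost all paths are
  nondecreasing.\<close>

definition poisson_process :: "'a measure \<Rightarrow> real \<Rightarrow> (real \<Rightarrow> 'a \<Rightarrow> nat) \<Rightarrow> bool" where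
  "poisson_process M r N \<longleftrightarrow>
     (\<forall>t\<ge>0. N t \<in> measurable M (count_space UNIV)) \<and>
     (AE \<omega> in M. N 0 \<omega> = 0) \<and>
     (AE \<omega> in M. mono_on {0..} (\<lambda>t. N t \<omega>) \<and>
        (\<forall>t\<ge>0. continuous (at_right t) (\<lambda>s. N s \<omega>))) \<and>
     (\<forall>s\<ge>0. \<forall>t>s. distr M (count_space UNIV) (\<lambda>\<omega>. N t \<omega> - N s \<omega>) =
        measure_pmf (poisson_pmf (r * (t - s)))) \<and>
     (\<forall>(\<tau>::nat \<Rightarrow> real) n. 0 \<le> \<tau> 0 \<longrightarrow> mono \<tau> \<longrightarrow>
        prob_space.indep_vars M (\<lambda>_. count_space UNIV)
          (\<lambda>i \<omega>. N (\<tau> (Suc i)) \<omega> - N (\<tau> i) \<omega>) {..<n})"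

definition compound_sum ::
    "(real \<Rightarrow> 'a \<Rightarrow> nat) \<Rightarrow> (nat \<Rightarrow> 'a \<Rightarrow> real) \<Rightarrow> real \<Rightarrow> 'a \<Rightarrow> real" where
  "compound_sum N X t \<omega> = (\<Sum>j=1..N t \<omega>. X j \<omega>)"

text \<open>The law of the process at time \<open>t\<close> has an atom of mass \<open>exp (- t)\<close> at \<open>0\<close>.\<close>

definition ac_component_density ::
    "'a measure \<Rightarrow> (real \<Rightarrow> 'a \<Rightarrow> real) \<Rightarrow> (real \<Rightarrow> real \<Rightarrow> real) \<Rightarrow> bool" where
  "ac_component_density M S f \<longleftrightarrow>
     (\<forall>t\<ge>0. (\<forall>x. 0 \<le> f x t) \<and> integrable lborel (\<lambda>x. f x t) \<and>
        (\<forall>y. measure M {\<omega> \<in> space M. S t \<omega> \<le> y} =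
               exp (- t) * indicator {0..} y + (LBINT x:{..y}. f x t)))"

definition fun_convolution :: "(real \<Rightarrow> real) \<Rightarrow> (real \<Rightarrow> real) \<Rightarrow> real \<Rightarrow> real" where
  "fun_convolution f g x = (LBINT z. f (x - z) * g z)"

text \<open>The \<open>n\<close>-fold convolution, for \<open>n \<ge> 1\<close>.\<close>

definition convolution_power :: "(real \<Rightarrow> real) \<Rightarrow> nat \<Rightarrow> real \<Rightarrow> real" where
  "convolution_power f n = (fun_convolution f ^^ (n - 1)) f"

text \<open>The version of the density of the absolutely continuous component given by the series
  over \<open>n \<ge> 1\<close> (a density being determined only almost everywhere).\<close>

definition compound_density :: "(real \<Rightarrow> real) \<Rightarrow> real \<Rightarrow> real \<Rightarrow> real" where
  "compound_density g x t =
     exp (- t) * (\<Sum>n. t ^ Suc n / fact (Suc n) * convolution_power g (Suc n) x)"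

end

theory Submission
  imports Defs
begin

text \<open>The obstacle is the origin. The only pointwise bound available there for the convolution
  powers is of order 1/x, so the series is controlled on intervals (a, b) with a > 0; on these the
  constants grow geometrically in n and are beaten by t^n / n!. Near 0 only integrability survives,
  so identities between convolutions are proved first as nonnegative integrals. There Tonelli
  applies freely, and finiteness at every x (not just almost every x) makes the real-valued
  integrals agree with them.

  An arbitrary competitor in the uniqueness proof has no such structure. Its x-derivative need not
  be continuous, so absolute continuity has to supply Lebesgue integrability, and its convolution
  with g is known only as a limit of truncated integrals. Its estimates therefore live in
  \<open>ennreal\<close>, may read \<open>\<infinity>\<close> at individual points, and become
  finite after integration over x, where the total mass 1 of g keeps the L1 norm from growing. The
  factor e^t absorbs the term - f. Vanishing of the L1 norm gives equality only almost everywhere;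
  feeding it back once into the pointwise estimate gives equality at each point with x > 0.\<close>

text \<open>All jumps share the rate \<open>\<kappa>\<close>, so the \<open>n\<close>-fold convolution of the jump density \<open>g\<close> is again a
  mixture of Gamma densities, the shape being a sum of \<open>n\<close> independent copies of \<open>\<rho>\<close>. This makes
  the series for the compound density \<open>f\<close> explicit enough to be differentiated termwise in \<open>x > 0\<close>.

  The kernel of the operator is the tail \<open>\<integral>\<^sub>y\<^sup>\<infinity> g\<close>, hence, after an integration by parts,
  \<open>\<D> f = f - g * f\<close>, and the equation becomes \<open>\<partial>\<^sub>t f = - f + g * f + e\<^sup>-\<^sup>t g\<close>, which the series
  \<open>e\<^sup>-\<^sup>t \<Sum> t\<^sup>n / n! g\<^sup>*\<^sup>n\<close> solves. For the difference of two solutions, multiplied by \<open>e\<^sup>t\<close>, the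
  \<open>L\<^sup>1\<close> norm \<open>m\<close> on a bounded interval satisfies \<open>m t \<le> \<integral>\<^sub>0\<^sup>t m\<close>, hence vanishes.\<close>

subsection \<open>Gamma densities\<close>

text \<open>The bound must be uniform in r, since it is applied under mixtures over r. It comes from
  keeping only [1, 2] in the Gamma integral: there exp (- w) is at least exp (- 2) and w powr (r -
  1) is at least 1/w, hence at least 1/2.\<close>

lemma rGamma_real_bounds:
  fixes r :: real
  assumes "0 < r"
  shows "0 \<le> rGamma r" and "rGamma r \<le> 2 * exp 2"
proof -
  have pos: "0 < Gamma r" using assms by (rule Gamma_real_pos)
  then show "0 \<le> rGamma r" by (simp add: rGamma_inverse_Gamma)
  have "exp (- 2) / 2 \<le> Gamma r"
  proof -
    have "(LBINT w:{1..2::real}. exp (- 2) / 2) \<le> (LBINT w:{0..}. exp (- w) * w powr (r - 1))"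
      unfolding set_lebesgue_integral_def
    proof (rule integral_mono)
      show "integrable lborel (\<lambda>w::real. indicat_real {1..2} w *\<^sub>R (exp (- 2) / 2::real))"
        by (intro integrable_scaleR_left integrable_real_indicator) auto
      show "integrable lborel (\<lambda>w. indicat_real {0..} w *\<^sub>R (exp (- w) * w powr (r - 1)))"
        using Gamma_set_integral(1)[OF assms] by (simp add: set_integrable_def)
      show "indicat_real {1..2} w *\<^sub>R (exp (- 2) / 2) \<le> indicat_real {0..} w *\<^sub>R (exp (- w) * w powr (r - 1))"
        for w :: real
      proof (cases "w \<in> {1..2}")
        case True
        have "1 / 2 \<le> w powr (- 1)" using True by (simp add: powr_minus divide_simps)
        also have "\<dots> \<le> w powr (r - 1)" using True assms by (intro powr_mono) auto
        finally have "exp (- 2) * (1 / 2) \<le> exp (- w) * w powr (r - 1)"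
          using True by (intro mult_mono) auto
        then show ?thesis using True by simp
      qed auto
    qed
    moreover have "(LBINT w:{1..2::real}. exp (- 2) / 2 :: real) = exp (- 2) / 2"
      by (simp add: set_lebesgue_integral_def)
    ultimately show ?thesis
      by (simp add: Gamma_set_integral(2)[OF assms])
  qed
  then show "rGamma r \<le> 2 * exp 2"
    using pos by (simp add: rGamma_inverse_Gamma field_simps exp_minus)
qed

text \<open>\<open>rGamma\<close> is continuous on the whole line, which makes joint measurability
  in shape and argument immediate. The open indicator agrees with the closed one in
  \<open>jump_density\<close>, because \<open>0 powr a = 0\<close>.\<close>

definition gamma_density :: "real \<Rightarrow> real \<Rightarrow> real \<Rightarrow> real" where
  "gamma_density \<kappa> r x =
     indicator {0<..} x * (exp (- \<kappa> * x) * (\<kappa> powr r * x powr (r - 1) * rGamma r))"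

lemma rGamma_measurable [measurable]: "(rGamma :: real \<Rightarrow> real) \<in> borel_measurable borel"
  by (intro borel_measurable_continuous_onI continuous_intros)

lemma gamma_density_measurable [measurable]:
  assumes [measurable]: "f \<in> borel_measurable M" "g \<in> borel_measurable M"
  shows "(\<lambda>w. gamma_density \<kappa> (f w) (g w)) \<in> borel_measurable M"
  unfolding gamma_density_def by measurable

lemma gamma_density_nonneg: "0 < r \<Longrightarrow> 0 \<le> gamma_density \<kappa> r x"
  by (simp add: gamma_density_def rGamma_real_bounds)

lemma gamma_density_eq_0: "x \<le> 0 \<Longrightarrow> gamma_density \<kappa> r x = 0"
  by (simp add: gamma_density_def)

text \<open>The common rate lets the exponentials merge into one factor independent of z; the
  substitution z = x t then leaves a Beta integral, whose value cancels the two normalising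
  constants against the one for a + b.\<close>

lemma gamma_density_convolution:
  assumes "0 < a" "0 < b"
  shows "(\<integral>\<^sup>+z. ennreal (gamma_density \<kappa> a (x - z)) * ennreal (gamma_density \<kappa> b z) \<partial>lborel)
    = ennreal (gamma_density \<kappa> (a + b) x)"
proof (cases "0 < x")
  case False
  then have "ennreal (gamma_density \<kappa> a (x - z)) * ennreal (gamma_density \<kappa> b z) = 0" for z
    by (cases "z \<le> 0") (auto simp: gamma_density_eq_0)
  then show ?thesis using False by (simp add: gamma_density_eq_0 del: mult_eq_0_iff)
next
  case True
  \<comment> \<open>Everything that does not depend on t. The exponent a + b - 2 is raised to a + b
    - 1 at the end by the Jacobian x.\<close>
  define c where "c = exp (- \<kappa> * x) * \<kappa> powr (a + b) * x powr (a + b - 2) * (rGamma a * rGamma b)"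
  have c: "0 \<le> c" unfolding c_def using assms by (auto simp: rGamma_real_bounds)
  let ?B = "\<lambda>t::real. indicator {0..1} t * (t powr (b - 1) * (1 - t) powr (a - 1))"
  have "(\<integral>\<^sup>+z. ennreal (gamma_density \<kappa> a (x - z)) * ennreal (gamma_density \<kappa> b z) \<partial>lborel)
     = ennreal x * (\<integral>\<^sup>+t. ennreal (gamma_density \<kappa> a (x - x * t)) * ennreal (gamma_density \<kappa> b (x * t)) \<partial>lborel)"
    using True by (subst nn_integral_real_affine[of _ x 0]) auto
  also have "(\<integral>\<^sup>+t. ennreal (gamma_density \<kappa> a (x - x * t)) * ennreal (gamma_density \<kappa> b (x * t)) \<partial>lborel)
     = (\<integral>\<^sup>+t. ennreal c * ennreal (?B t) \<partial>lborel)"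
  proof (rule nn_integral_cong)
    fix t :: real
    have "gamma_density \<kappa> a (x - x * t) * gamma_density \<kappa> b (x * t) = c * ?B t"
    proof (cases "t \<in> {0<..<1}")
      case t: True
      have xt: "x - x * t = x * (1 - t)" by (simp add: algebra_simps)
      have pos: "0 < x * (1 - t)" "0 < x * t" using t True by auto
      have e: "exp (- \<kappa> * (x * (1 - t))) * exp (- \<kappa> * (x * t)) = exp (- \<kappa> * x)"
        by (simp add: exp_add[symmetric] algebra_simps)
      have p: "x powr (a - 1) * x powr (b - 1) = x powr (a + b - 2)"
        using True by (simp add: powr_add[symmetric] algebra_simps)
      have k: "\<kappa> powr a * \<kappa> powr b = \<kappa> powr (a + b)" by (simp add: powr_add)
      have "gamma_density \<kappa> a (x - x * t) * gamma_density \<kappa> b (x * t)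
        = (exp (- \<kappa> * (x * (1 - t))) * exp (- \<kappa> * (x * t))) * (\<kappa> powr a * \<kappa> powr b)
          * (x powr (a - 1) * x powr (b - 1)) * (rGamma a * rGamma b)
          * (t powr (b - 1) * (1 - t) powr (a - 1))"
      proof -
        have pm: "(x * (1 - t)) powr (a - 1) = x powr (a - 1) * (1 - t) powr (a - 1)"
          "(x * t) powr (b - 1) = x powr (b - 1) * t powr (b - 1)"
          using t True by (auto intro!: powr_mult)
        show ?thesis
          unfolding gamma_density_def xt pm using pos by (simp only: indicator_simps greaterThan_iff mult_ac mult_1)
      qed
      then show ?thesis unfolding e p k using t by (simp add: c_def)
    next
      case False
      then have "x - x * t \<le> 0 \<or> x * t \<le> 0"
        using True by (auto simp: mult_le_0_iff not_less)
      \<comment> \<open>At the endpoints t = 0 and t = 1 this rests on the convention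
        \<open>0 powr a = 0\<close>.\<close>
      moreover have "?B t = 0" using False by (auto simp: indicator_def)
      ultimately show ?thesis by (auto simp: gamma_density_eq_0)
    qed
    then show "ennreal (gamma_density \<kappa> a (x - x * t)) * ennreal (gamma_density \<kappa> b (x * t)) =
        ennreal c * ennreal (?B t)"
      using c assms by (simp flip: ennreal_mult' add: gamma_density_nonneg)
  qed
  also have "\<dots> = ennreal c * (\<integral>\<^sup>+t. ennreal (?B t) \<partial>lborel)"
    by (rule nn_integral_cmult) measurable
  also have "(\<integral>\<^sup>+t. ennreal (?B t) \<partial>lborel) = ennreal (Beta b a)"
  proof (rule nn_integral_has_integral_lborel)
    have "((\<lambda>t. t powr (b - 1) * (1 - t) powr (a - 1)) has_integral Beta b a) {0..1}"
      using assms by (intro has_integral_Beta_real)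
    then have "((\<lambda>t. if t \<in> {0..1} then t powr (b - 1) * (1 - t) powr (a - 1) else 0) has_integral Beta b a) UNIV"
      by (subst has_integral_restrict_UNIV)
    moreover have "(\<lambda>t. if t \<in> {0..1} then t powr (b - 1) * (1 - t) powr (a - 1) else 0) = ?B"
      by (auto simp: indicator_def fun_eq_iff)
    ultimately show "(?B has_integral Beta b a) UNIV" by simp
  qed auto
  also have "ennreal x * (ennreal c * ennreal (Beta b a)) = ennreal (x * (c * Beta b a))"
    using True c by (simp add: ennreal_mult')
  also have "x * (c * Beta b a) = gamma_density \<kappa> (a + b) x"
  proof -
    have "0 < Gamma a" "0 < Gamma b" using assms by (auto intro: Gamma_real_pos)
    then have B: "rGamma a * rGamma b * Beta b a = rGamma (a + b)"
      by (simp add: Beta_def rGamma_inverse_Gamma field_simps)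
    have "x * x powr (a + b - 2) = x powr (1 + (a + b - 2))"
      unfolding powr_add using True by simp
    then have p: "x * x powr (a + b - 2) = x powr (a + b - 1)" by simp
    have "x * (c * Beta b a) = exp (- \<kappa> * x) * \<kappa> powr (a + b) * (x * x powr (a + b - 2)) * (rGamma a * rGamma b * Beta b a)"
      by (simp add: c_def)
    then show ?thesis unfolding p B gamma_density_def using True by simp
  qed
  finally show ?thesis .
qed

text \<open>The substitution w = \<kappa> u in the incomplete Gamma integral: the normalised
  incomplete Gamma function is the tail probability of a Gamma law. This is what links the kernel of
  the operator to the jumps.\<close>

lemma gamma_density_tail:
  assumes "0 < \<kappa>" "0 < r" "0 \<le> y"
  shows "(\<integral>\<^sup>+u. ennreal (gamma_density \<kappa> r u) * indicator {y..} u \<partial>lborel)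
    = ennreal (upper_Gamma r (\<kappa> * y) / Gamma r)"
proof -
  let ?f = "\<lambda>w. indicator {\<kappa> * y..} w * (exp (- w) * w powr (r - 1))"
  have G: "0 < Gamma r" using assms by (auto intro: Gamma_real_pos)
  have "set_integrable lborel {\<kappa> * y..} (\<lambda>w. exp (- w) * w powr (r - 1))"
    by (rule set_integrable_subset[OF Gamma_set_integral(1)[OF assms(2)]]) (use assms in auto)
  then have int: "integrable lborel ?f" by (simp add: set_integrable_def)
  have "ennreal (upper_Gamma r (\<kappa> * y)) = (\<integral>\<^sup>+w. ennreal (?f w) \<partial>lborel)"
    unfolding upper_Gamma_def set_lebesgue_integral_def
    using int by (subst nn_integral_eq_integral) auto
  also have "\<dots> = ennreal \<kappa> * (\<integral>\<^sup>+u. ennreal (?f (\<kappa> * u)) \<partial>lborel)"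
    using assms by (subst nn_integral_real_affine[of _ \<kappa> 0]) auto
  also have "\<dots> = (\<integral>\<^sup>+u. ennreal \<kappa> * ennreal (?f (\<kappa> * u)) \<partial>lborel)"
    by (rule nn_integral_cmult[symmetric]) measurable
  finally have 1: "ennreal (upper_Gamma r (\<kappa> * y)) = \<dots>" .
  have "ennreal (upper_Gamma r (\<kappa> * y) / Gamma r) = ennreal (rGamma r) * ennreal (upper_Gamma r (\<kappa> * y))"
    using assms by (simp add: rGamma_inverse_Gamma divide_inverse mult.commute ennreal_mult' upper_Gamma_bounds)
  also have "\<dots> = (\<integral>\<^sup>+u. ennreal (rGamma r) * (ennreal \<kappa> * ennreal (?f (\<kappa> * u))) \<partial>lborel)"
    unfolding 1 by (rule nn_integral_cmult[symmetric]) measurable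
  also have "\<dots> = (\<integral>\<^sup>+u. ennreal (gamma_density \<kappa> r u) * indicator {y..} u \<partial>lborel)"
  proof (rule nn_integral_cong)
    fix u :: real
    have k: "\<kappa> * \<kappa> powr (r - 1) = \<kappa> powr r"
    proof -
      have "\<kappa> * \<kappa> powr (r - 1) = \<kappa> powr (1 + (r - 1))"
        unfolding powr_add using assms by simp
      then show ?thesis by simp
    qed
    have "rGamma r * (\<kappa> * ?f (\<kappa> * u)) = gamma_density \<kappa> r u * indicator {y..} u"
    proof (cases "y \<le> u")
      case True
      then have "0 \<le> u" using assms by simp
      then have "rGamma r * (\<kappa> * ?f (\<kappa> * u)) = exp (- \<kappa> * u) * (\<kappa> * \<kappa> powr (r - 1)) * u powr (r - 1) * rGamma r"
        using True assms by (simp add: powr_mult)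
      then show ?thesis
        unfolding k gamma_density_def using True \<open>0 \<le> u\<close> by (cases "u = 0") auto
    qed (use assms in auto)
    moreover have "0 \<le> ?f (\<kappa> * u)" by simp
    ultimately show "ennreal (rGamma r) * (ennreal \<kappa> * ennreal (?f (\<kappa> * u))) = ennreal (gamma_density \<kappa> r u) * indicator {y..} u"
      using assms
      by (simp flip: ennreal_mult' ennreal_indicator add: gamma_density_nonneg rGamma_real_bounds)
  qed
  finally show ?thesis by simp
qed

subsection \<open>Mixtures over the shape parameter\<close>

lemma nn_integral_eq_integral_finite:
  assumes "f \<in> borel_measurable M" "\<And>x. 0 \<le> f x" "(\<integral>\<^sup>+x. ennreal (f x) \<partial>M) < \<infinity>"
  shows "integrable M f" and "ennreal (\<integral>x. f x \<partial>M) = (\<integral>\<^sup>+x. ennreal (f x) \<partial>M)"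
proof -
  show *: "integrable M f"
    using assms by (intro integrableI_nonneg) auto
  show "ennreal (\<integral>x. f x \<partial>M) = (\<integral>\<^sup>+x. ennreal (f x) \<partial>M)"
    using nn_integral_eq_integral[OF *] assms(2) by simp
qed

text \<open>Writing x powr (r - 1) as x powr r / x isolates a singularity of order 1/x. The
  remaining powers have exponents between 0 and n, so replacing each base by its maximum with 1
  gives a bound that no longer depends on r and is geometric in n.\<close>

lemma gamma_density_le:
  assumes "0 < \<kappa>" "0 < r" "r \<le> real n" "0 < x"
  shows "gamma_density \<kappa> r x \<le> 2 * exp 2 * (max 1 \<kappa> * max 1 x) ^ n / x"
proof -
  have p: "y powr r \<le> max 1 y ^ n" if "0 < y" for y :: real
  proof -
    have "y powr r \<le> max 1 y powr r" using that assms by (intro powr_mono2) auto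
    also have "\<dots> \<le> max 1 y powr real n" using assms by (intro powr_mono) auto
    also have "\<dots> = max 1 y ^ n" by (rule powr_realpow) auto
    finally show ?thesis .
  qed
  have x: "x powr (r - 1) = x powr r / x" using assms by (simp add: powr_diff)
  have "gamma_density \<kappa> r x = exp (- \<kappa> * x) * ((\<kappa> powr r * x powr r * rGamma r) / x)"
    using assms by (simp add: gamma_density_def x)
  also have "\<dots> \<le> 1 * ((max 1 \<kappa> ^ n * max 1 x ^ n * (2 * exp 2)) / x)"
    using assms by (intro mult_mono divide_right_mono p rGamma_real_bounds) (auto simp: rGamma_real_bounds)
  also have "\<dots> = 2 * exp 2 * (max 1 \<kappa> * max 1 x) ^ n / x"
    by (simp add: power_mult_distrib)
  finally show ?thesis .
qed

lemma gamma_density_mass: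
  assumes "0 < \<kappa>" "0 < r"
  shows "(\<integral>\<^sup>+u. ennreal (gamma_density \<kappa> r u) \<partial>lborel) = 1"
proof -
  have "(\<integral>\<^sup>+u. ennreal (gamma_density \<kappa> r u) \<partial>lborel)
      = (\<integral>\<^sup>+u. ennreal (gamma_density \<kappa> r u) * indicator {0..} u \<partial>lborel)"
    by (intro nn_integral_cong) (auto simp: indicator_def gamma_density_eq_0)
  also have "\<dots> = ennreal (upper_Gamma r 0 / Gamma r)"
    using gamma_density_tail[OF assms, of 0] by simp
  also have "upper_Gamma r 0 = Gamma r"
    using assms by (simp add: upper_Gamma_def Gamma_set_integral(2))
  finally show ?thesis using Gamma_real_pos[OF assms(2)] by simp
qed

section \<open>Laws of sums of independent shapes, and convolution powers as mixtures\<close>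

locale shape_mixture =
  fixes \<kappa> :: real and q :: "real \<Rightarrow> real"
  assumes rate_pos: "0 < \<kappa>"
    and q_measurable [measurable]: "q \<in> borel_measurable borel"
    and q_nonneg: "\<And>r. 0 \<le> q r"
    and q_mass: "(\<integral>\<^sup>+r. ennreal (q r) * indicator {0<..<1} r \<partial>lborel) = 1"
begin

definition shape :: "real measure" where
  "shape = density lborel (\<lambda>r. ennreal (q r) * indicator {0<..<1} r)"

text \<open>Index shift: \<open>shape_power n\<close> is the law of a sum of n + 1 independent
  shapes, in step with \<open>convolution_power\<close> at \<open>Suc n\<close>.\<close>

primrec shape_power :: "nat \<Rightarrow> real measure" where
  "shape_power 0 = shape"
| "shape_power (Suc n) = convolution shape (shape_power n)"

lemma sets_shape [measurable_cong, simp]: "sets shape = sets borel"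
  by (simp add: shape_def)

lemma sets_shape_power [measurable_cong, simp]: "sets (shape_power n) = sets borel"
  by (cases n) auto

lemma nn_integral_shape:
  assumes [measurable]: "f \<in> borel_measurable borel"
  shows "(\<integral>\<^sup>+r. f r \<partial>shape) = (\<integral>\<^sup>+r. ennreal (q r) * indicator {0<..<1} r * f r \<partial>lborel)"
  unfolding shape_def by (rule nn_integral_density) auto

sublocale shape: prob_space shape
  by (rule prob_spaceI) (simp add: shape_def emeasure_density q_mass)

lemma prob_space_shape_power: "prob_space (shape_power n)"
proof (induction n)
  case 0
  show ?case by (simp add: shape.prob_space_axioms)
next
  case (Suc n)
  interpret S: prob_space "shape_power n" by fact
  have "emeasure (shape_power (Suc n)) UNIV = (\<integral>\<^sup>+x. 1 \<partial>(convolution shape (shape_power n)))"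
    by simp
  also have "\<dots> = 1"
    by (subst nn_integral_convolution)
      (auto simp: shape.finite_measure_axioms S.finite_measure_axioms shape.emeasure_space_1 S.emeasure_space_1)
  finally show ?case
    by (intro prob_spaceI) simp
qed

sublocale shape_power: prob_space "shape_power n" for n
  by (rule prob_space_shape_power)

lemma AE_shape: "AE r in shape. 0 < r \<and> r < 1"
  unfolding shape_def by (subst AE_density) (auto simp: indicator_def)

text \<open>The upper bound is the point: it is what allows \<open>gamma_density_le\<close> to be
  applied with the exponent \<open>Suc n\<close>. The induction integrates the indicator of the
  exceptional set against the convolution of the two laws.\<close>

lemma AE_shape_power: "AE r in shape_power n. 0 < r \<and> r < real (Suc n)"
proof (induction n)
  case 0
  show ?case using AE_shape unfolding shape_power.simps by simp
next
  case (Suc n)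
  let ?A = "{r::real. \<not> (0 < r \<and> r < real (Suc (Suc n)))}"
  have [measurable]: "?A \<in> sets borel" by measurable
  have "(\<integral>\<^sup>+x. indicator ?A x \<partial>(convolution shape (shape_power n)))
      = (\<integral>\<^sup>+r. \<integral>\<^sup>+s. indicator ?A (r + s) \<partial>shape_power n \<partial>shape)"
    by (rule nn_integral_convolution) (auto simp: shape.finite_measure_axioms shape_power.finite_measure_axioms)
  also have "\<dots> = (\<integral>\<^sup>+r. 0 \<partial>shape)"
  proof (rule nn_integral_cong_AE, use AE_shape in eventually_elim)
    fix r :: real assume r: "0 < r \<and> r < 1"
    have "(\<integral>\<^sup>+s. indicator ?A (r + s) \<partial>shape_power n) = (\<integral>\<^sup>+s. 0 \<partial>shape_power n)"
      using Suc by (intro nn_integral_cong_AE, eventually_elim) (use r in \<open>auto simp: indicator_def\<close>)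
    then show "(\<integral>\<^sup>+s. indicator ?A (r + s) \<partial>shape_power n) = (0::ennreal)" by simp
  qed
  finally have "emeasure (shape_power (Suc n)) ?A = 0"
    by (simp add: nn_integral_indicator)
  then show ?case
    by (subst AE_iff_measurable[OF _ refl]) auto
qed

lemma nn_integral_gamma_density_le:
  assumes "0 < x"
  shows "(\<integral>\<^sup>+r. ennreal (gamma_density \<kappa> r x) \<partial>shape_power n)
    \<le> ennreal (2 * exp 2 * (max 1 \<kappa> * max 1 x) ^ Suc n / x)"
proof -
  have "(\<integral>\<^sup>+r. ennreal (gamma_density \<kappa> r x) \<partial>shape_power n)
      \<le> (\<integral>\<^sup>+r. ennreal (2 * exp 2 * (max 1 \<kappa> * max 1 x) ^ Suc n / x) \<partial>shape_power n)"
    using AE_shape_power[of n]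
    by (intro nn_integral_mono_AE, eventually_elim)
      (use assms rate_pos in \<open>auto intro!: ennreal_leI gamma_density_le simp del: power_Suc\<close>)
  then show ?thesis by (simp add: shape_power.emeasure_space_1)
qed

lemma nn_integral_gamma_density_finite:
  "(\<integral>\<^sup>+r. ennreal (gamma_density \<kappa> r x) \<partial>shape_power n) < \<infinity>"
proof (cases "0 < x")
  case True
  then show ?thesis
    using nn_integral_gamma_density_le[OF True, of n] by (auto intro: le_less_trans)
qed (simp add: gamma_density_eq_0)

lemma jump_density_nonneg: "0 \<le> jump_density \<kappa> q x"
  unfolding jump_density_def set_lebesgue_integral_def
  by (intro mult_nonneg_nonneg Bochner_Integration.integral_nonneg)
    (auto simp: indicator_def q_nonneg Gamma_real_pos less_imp_le)

lemma jump_density_eq_nn_integral: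
  "ennreal (jump_density \<kappa> q x) = (\<integral>\<^sup>+r. ennreal (gamma_density \<kappa> r x) \<partial>shape)"
proof -
  let ?h = "\<lambda>r. indicator {0<..<1} r * (q r * gamma_density \<kappa> r x)"
  have nn: "(\<integral>\<^sup>+r. ennreal (?h r) \<partial>lborel) = (\<integral>\<^sup>+r. ennreal (gamma_density \<kappa> r x) \<partial>shape)"
    by (subst nn_integral_shape)
      (auto intro!: nn_integral_cong simp: indicator_def ennreal_mult q_nonneg gamma_density_nonneg)
  have "jump_density \<kappa> q x = (\<integral>r. ?h r \<partial>lborel)"
  proof (cases "0 < x")
    case True
    then show ?thesis
      unfolding jump_density_def set_lebesgue_integral_def gamma_density_def
      by (simp flip: integral_mult_right_zero
          add: rGamma_inverse_Gamma divide_inverse mult_ac)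
  next
    case False
    \<comment> \<open>At x = 0 the closed indicator equals 1, but \<open>0 powr a = 0\<close> makes
      the integrand vanish.\<close>
    then show ?thesis
      by (auto simp: jump_density_def gamma_density_eq_0 indicator_def)
  qed
  also have "ennreal \<dots> = (\<integral>\<^sup>+r. ennreal (?h r) \<partial>lborel)"
    using nn_integral_gamma_density_finite[of 0 x] nn
    by (intro nn_integral_eq_integral_finite)
      (auto simp: indicator_def q_nonneg gamma_density_nonneg)
  finally show ?thesis unfolding nn .
qed

lemma jump_density_measurable [measurable]: "jump_density \<kappa> q \<in> borel_measurable borel"
proof -
  have "jump_density \<kappa> q = (\<lambda>x. enn2real (\<integral>\<^sup>+r. ennreal (gamma_density \<kappa> r x) \<partial>shape))"
    by (simp flip: jump_density_eq_nn_integral add: jump_density_nonneg)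
  also have "\<dots> \<in> borel_measurable borel" by measurable
  finally show ?thesis .
qed

lemma convolution_power_Suc:
  "convolution_power f (Suc (Suc n)) x = (LBINT z. f (x - z) * convolution_power f (Suc n) z)"
  by (simp add: convolution_power_def fun_convolution_def)

text \<open>Two applications of Tonelli move the integral over z innermost, where
  \<open>gamma_density_convolution\<close> adds the shapes for almost every pair r, s; what remains
  is integration against the convolution of the two shape laws.\<close>

lemma shape_power_convolution:
  "(\<integral>\<^sup>+z. (\<integral>\<^sup>+r. ennreal (gamma_density \<kappa> r (x - z)) \<partial>shape)
      * (\<integral>\<^sup>+s. ennreal (gamma_density \<kappa> s z) \<partial>shape_power n) \<partial>lborel)
    = (\<integral>\<^sup>+r. ennreal (gamma_density \<kappa> r x) \<partial>shape_power (Suc n))"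
proof -
  interpret SL: pair_sigma_finite shape lborel ..
  interpret PL: pair_sigma_finite "shape_power n" lborel ..
  have "(\<integral>\<^sup>+z. (\<integral>\<^sup>+r. ennreal (gamma_density \<kappa> r (x - z)) \<partial>shape)
      * (\<integral>\<^sup>+s. ennreal (gamma_density \<kappa> s z) \<partial>shape_power n) \<partial>lborel)
      = (\<integral>\<^sup>+z. \<integral>\<^sup>+r. \<integral>\<^sup>+s. ennreal (gamma_density \<kappa> r (x - z)) * ennreal (gamma_density \<kappa> s z) \<partial>shape_power n \<partial>shape \<partial>lborel)"
    by (intro nn_integral_cong) (simp add: nn_integral_cmult nn_integral_multc)
  also have "\<dots> = (\<integral>\<^sup>+r. \<integral>\<^sup>+z. \<integral>\<^sup>+s. ennreal (gamma_density \<kappa> r (x - z)) * ennreal (gamma_density \<kappa> s z) \<partial>shape_power n \<partial>lborel \<partial>shape)"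
    by (rule SL.Fubini') measurable
  also have "\<dots> = (\<integral>\<^sup>+r. \<integral>\<^sup>+s. \<integral>\<^sup>+z. ennreal (gamma_density \<kappa> r (x - z)) * ennreal (gamma_density \<kappa> s z) \<partial>lborel \<partial>shape_power n \<partial>shape)"
    by (intro nn_integral_cong PL.Fubini') measurable
  also have "\<dots> = (\<integral>\<^sup>+r. \<integral>\<^sup>+s. ennreal (gamma_density \<kappa> (r + s) x) \<partial>shape_power n \<partial>shape)"
  proof (rule nn_integral_cong_AE, use AE_shape in eventually_elim)
    fix r :: real assume r: "0 < r \<and> r < 1"
    show "(\<integral>\<^sup>+s. \<integral>\<^sup>+z. ennreal (gamma_density \<kappa> r (x - z)) * ennreal (gamma_density \<kappa> s z) \<partial>lborel \<partial>shape_power n)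
        = (\<integral>\<^sup>+s. ennreal (gamma_density \<kappa> (r + s) x) \<partial>shape_power n)"
      using AE_shape_power[of n]
      by (intro nn_integral_cong_AE, eventually_elim) (use r in \<open>simp add: gamma_density_convolution\<close>)
  qed
  also have "\<dots> = (\<integral>\<^sup>+r. ennreal (gamma_density \<kappa> r x) \<partial>shape_power (Suc n))"
    by (simp, subst nn_integral_convolution)
      (auto simp: shape.finite_measure_axioms shape_power.finite_measure_axioms)
  finally show ?thesis .
qed

text \<open>Nonnegativity and the formula go through one induction because each step needs both.
  Finiteness of the mixture at every x ensures that the Bochner integral in
  \<open>fun_convolution\<close> is the true value and not the default 0 for non-integrable
  functions.\<close>

lemma convolution_power_eq_nn_integral:
  "0 \<le> convolution_power (jump_density \<kappa> q) (Suc n) x \<and>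
   ennreal (convolution_power (jump_density \<kappa> q) (Suc n) x)
     = (\<integral>\<^sup>+r. ennreal (gamma_density \<kappa> r x) \<partial>shape_power n)"
proof (induction n arbitrary: x)
  case 0
  show ?case
    by (simp add: convolution_power_def jump_density_nonneg jump_density_eq_nn_integral)
next
  case (Suc n)
  let ?G = "convolution_power (jump_density \<kappa> q) (Suc n)"
  have pos: "0 \<le> ?G z" for z using Suc by blast
  have G: "ennreal (?G z) = (\<integral>\<^sup>+r. ennreal (gamma_density \<kappa> r z) \<partial>shape_power n)" for z
    using Suc by blast
  have "?G = (\<lambda>x. enn2real (\<integral>\<^sup>+r. ennreal (gamma_density \<kappa> r x) \<partial>shape_power n))"
    by (simp flip: G add: pos)
  also have "\<dots> \<in> borel_measurable borel" by measurable
  finally have [measurable]: "?G \<in> borel_measurable borel" .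
  have *: "(\<integral>\<^sup>+z. ennreal (jump_density \<kappa> q (x - z) * ?G z) \<partial>lborel)
      = (\<integral>\<^sup>+r. ennreal (gamma_density \<kappa> r x) \<partial>shape_power (Suc n))"
    unfolding shape_power_convolution[symmetric]
    by (simp add: ennreal_mult pos jump_density_nonneg jump_density_eq_nn_integral G)
  have "ennreal (LBINT z. jump_density \<kappa> q (x - z) * ?G z)
      = (\<integral>\<^sup>+z. ennreal (jump_density \<kappa> q (x - z) * ?G z) \<partial>lborel)"
    using nn_integral_gamma_density_finite[of "Suc n" x] unfolding *[symmetric]
    by (intro nn_integral_eq_integral_finite) (auto simp: jump_density_nonneg pos)
  moreover have "0 \<le> (LBINT z. jump_density \<kappa> q (x - z) * ?G z)"
    by (intro Bochner_Integration.integral_nonneg) (simp add: jump_density_nonneg pos)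
  ultimately show ?case
    unfolding convolution_power_Suc * by blast
qed

lemmas convolution_power_nonneg = convolution_power_eq_nn_integral[THEN conjunct1]

lemma convolution_power_measurable [measurable]:
  "convolution_power (jump_density \<kappa> q) (Suc n) \<in> borel_measurable borel"
proof -
  have "convolution_power (jump_density \<kappa> q) (Suc n)
      = (\<lambda>x. enn2real (\<integral>\<^sup>+r. ennreal (gamma_density \<kappa> r x) \<partial>shape_power n))"
    by (simp flip: convolution_power_eq_nn_integral add: convolution_power_nonneg)
  also have "\<dots> \<in> borel_measurable borel" by measurable
  finally show ?thesis .
qed

lemma nn_integral_convolution_power_Suc:
  "ennreal (convolution_power (jump_density \<kappa> q) (Suc (Suc n)) x)
    = (\<integral>\<^sup>+z. ennreal (jump_density \<kappa> q (x - z)) * ennreal (convolution_power (jump_density \<kappa> q) (Suc n) z) \<partial>lborel)"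
  unfolding convolution_power_eq_nn_integral[THEN conjunct2] jump_density_eq_nn_integral
    shape_power_convolution ..

lemma convolution_power_eq_0: "x \<le> 0 \<Longrightarrow> convolution_power (jump_density \<kappa> q) (Suc n) x = 0"
  using convolution_power_eq_nn_integral[of n x] by (simp add: gamma_density_eq_0 ennreal_eq_0_iff)

lemma convolution_power_mass:
  "(\<integral>\<^sup>+x. ennreal (convolution_power (jump_density \<kappa> q) (Suc n) x) \<partial>lborel) = 1"
proof -
  interpret PL: pair_sigma_finite "shape_power n" lborel ..
  have "(\<integral>\<^sup>+x. ennreal (convolution_power (jump_density \<kappa> q) (Suc n) x) \<partial>lborel)
      = (\<integral>\<^sup>+r. \<integral>\<^sup>+x. ennreal (gamma_density \<kappa> r x) \<partial>lborel \<partial>shape_power n)"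
    unfolding convolution_power_eq_nn_integral[THEN conjunct2]
    by (rule PL.Fubini') measurable
  also have "\<dots> = (\<integral>\<^sup>+r. 1 \<partial>shape_power n)"
    using AE_shape_power[of n]
    by (intro nn_integral_cong_AE, eventually_elim) (simp add: gamma_density_mass rate_pos)
  finally show ?thesis by (simp add: shape_power.emeasure_space_1)
qed

lemma jump_density_mass: "(\<integral>\<^sup>+x. ennreal (jump_density \<kappa> q x) \<partial>lborel) = 1"
  using convolution_power_mass[of 0] by (simp add: convolution_power_def)

text \<open>\<open>gamma_density_tail\<close> for each fixed shape, then Tonelli over the shape. The
  normalised incomplete Gamma function lies in [0, 1], so the integral defining the kernel
  converges.\<close>

lemma conv_kernel_eq_tail:
  assumes "0 \<le> y"
  shows "0 \<le> conv_kernel \<kappa> q y"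
    and "ennreal (conv_kernel \<kappa> q y) = (\<integral>\<^sup>+u. ennreal (jump_density \<kappa> q u) * indicator {y..} u \<partial>lborel)"
proof -
  interpret SL: pair_sigma_finite shape lborel ..
  let ?U = "\<lambda>r. upper_Gamma r (\<kappa> * y) * rGamma r"
  let ?h = "\<lambda>r. indicator {0<..<1} r * (q r * ?U r)"
  have [measurable]: "(\<lambda>r. upper_Gamma r (\<kappa> * y)) \<in> borel_measurable borel"
    using measurable_compose[of "\<lambda>r::real. (r, \<kappa> * y)" borel borel "case_prod upper_Gamma"] upper_Gamma_measurable
    by simp
  have U: "0 \<le> ?U r" "?U r \<le> 1" if "0 < r" for r
    using upper_Gamma_bounds[OF that, of "\<kappa> * y"] Gamma_real_pos[OF that] assms rate_pos
    by (auto simp: rGamma_inverse_Gamma field_simps)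
  have K: "conv_kernel \<kappa> q y = (\<integral>r. ?h r \<partial>lborel)"
    unfolding conv_kernel_def set_lebesgue_integral_def
    by (simp add: rGamma_inverse_Gamma divide_inverse mult_ac)
  have nn: "(\<integral>\<^sup>+r. ennreal (?h r) \<partial>lborel) = (\<integral>\<^sup>+r. ennreal (?U r) \<partial>shape)"
    by (subst nn_integral_shape)
      (auto intro!: nn_integral_cong simp: indicator_def ennreal_mult'[OF q_nonneg])
  also have fin: "\<dots> \<le> (\<integral>\<^sup>+r. 1 \<partial>shape)"
    using AE_shape by (intro nn_integral_mono_AE, eventually_elim) (use U in \<open>simp add: ennreal_le_1\<close>)
  finally have fin: "(\<integral>\<^sup>+r. ennreal (?h r) \<partial>lborel) < \<infinity>"
    by (simp add: shape.emeasure_space_1 le_less_trans)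
  show "0 \<le> conv_kernel \<kappa> q y"
    unfolding K by (rule Bochner_Integration.integral_nonneg) (use U q_nonneg in \<open>auto simp: indicator_def\<close>)
  have "ennreal (conv_kernel \<kappa> q y) = (\<integral>\<^sup>+r. ennreal (?U r) \<partial>shape)"
    unfolding K nn[symmetric]
    by (rule nn_integral_eq_integral_finite(2)[OF _ _ fin]) (use U q_nonneg in \<open>auto simp: indicator_def\<close>)
  also have "\<dots> = (\<integral>\<^sup>+r. \<integral>\<^sup>+u. ennreal (gamma_density \<kappa> r u) * indicator {y..} u \<partial>lborel \<partial>shape)"
    using AE_shape
    by (intro nn_integral_cong_AE, eventually_elim)
      (use assms rate_pos in \<open>simp add: gamma_density_tail rGamma_inverse_Gamma divide_inverse\<close>)
  also have "\<dots> = (\<integral>\<^sup>+u. \<integral>\<^sup>+r. ennreal (gamma_density \<kappa> r u) * indicator {y..} u \<partial>shape \<partial>lborel)"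
    by (rule SL.Fubini'[symmetric]) measurable
  also have "\<dots> = (\<integral>\<^sup>+u. ennreal (jump_density \<kappa> q u) * indicator {y..} u \<partial>lborel)"
    by (simp add: nn_integral_multc jump_density_eq_nn_integral)
  finally show "ennreal (conv_kernel \<kappa> q y) = (\<integral>\<^sup>+u. ennreal (jump_density \<kappa> q u) * indicator {y..} u \<partial>lborel)" .
qed

end

subsection \<open>Regularity of the compound density\<close>

text \<open>Differentiation under the integral sign: dominated convergence along arbitrary sequences
  tending to x, applied to difference quotients.\<close>

lemma has_real_derivative_lebesgue_integral:
  fixes f :: "real \<Rightarrow> 'a \<Rightarrow> real"
  assumes x: "x \<in> {a<..<b}"
    and int: "\<And>y. y \<in> {a<..<b} \<Longrightarrow> integrable M (f y)"
    and meas: "f' x \<in> borel_measurable M"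
    and B: "integrable M B"
    and der: "AE \<omega> in M. \<forall>y\<in>{a<..<b}. ((\<lambda>y. f y \<omega>) has_real_derivative f' y \<omega>) (at y) \<and> \<bar>f' y \<omega>\<bar> \<le> B \<omega>"
  shows "((\<lambda>y. \<integral>\<omega>. f y \<omega> \<partial>M) has_real_derivative (\<integral>\<omega>. f' x \<omega> \<partial>M)) (at x)"
proof -
  have "((\<lambda>y. ((\<integral>\<omega>. f y \<omega> \<partial>M) - (\<integral>\<omega>. f x \<omega> \<partial>M)) / (y - x)) \<longlongrightarrow> (\<integral>\<omega>. f' x \<omega> \<partial>M)) (at x within {a<..<b})"
    unfolding tendsto_at_iff_sequentially
  proof (intro allI impI)
    fix X :: "nat \<Rightarrow> real" assume X: "\<forall>i. X i \<in> {a<..<b} - {x}" "X \<longlonglongrightarrow> x"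
    have intX: "integrable M (f (X n))" for n using X(1) by (intro int) blast
    have meas_q: "(\<lambda>\<omega>. (f (X n) \<omega> - f x \<omega>) / (X n - x)) \<in> borel_measurable M" for n
      by (intro borel_measurable_divide borel_measurable_diff borel_measurable_const
        borel_measurable_integrable[OF intX] borel_measurable_integrable[OF int[OF x]])
    have *: "(\<lambda>n. \<integral>\<omega>. (f (X n) \<omega> - f x \<omega>) / (X n - x) \<partial>M) \<longlonglongrightarrow> (\<integral>\<omega>. f' x \<omega> \<partial>M)"
    proof (rule integral_dominated_convergence[OF meas meas_q B])
      show "AE \<omega> in M. (\<lambda>n. (f (X n) \<omega> - f x \<omega>) / (X n - x)) \<longlonglongrightarrow> f' x \<omega>"
        using der
      proof eventually_elim
        fix \<omega> assume *: "\<forall>y\<in>{a<..<b}. ((\<lambda>y. f y \<omega>) has_real_derivative f' y \<omega>) (at y) \<and> \<bar>f' y \<omega>\<bar> \<le> B \<omega>"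
        then have "((\<lambda>y. f y \<omega>) has_real_derivative f' x \<omega>) (at x)"
          using x by blast
        then have "((\<lambda>y. (f y \<omega> - f x \<omega>) / (y - x)) \<longlongrightarrow> f' x \<omega>) (at x)"
          by (rule has_field_derivative_iff[THEN iffD1])
        then have "((\<lambda>y. (f y \<omega> - f x \<omega>) / (y - x)) \<circ> X) \<longlonglongrightarrow> f' x \<omega>"
          using X by (elim tendsto_at_iff_sequentially[THEN iffD1, rule_format]) auto
        then show "(\<lambda>n. (f (X n) \<omega> - f x \<omega>) / (X n - x)) \<longlonglongrightarrow> f' x \<omega>"
          unfolding o_def .
      qed
      show "AE \<omega> in M. norm ((f (X n) \<omega> - f x \<omega>) / (X n - x)) \<le> B \<omega>" for n
        using der
      proof eventually_elim
        fix \<omega> assume *: "\<forall>y\<in>{a<..<b}. ((\<lambda>y. f y \<omega>) has_real_derivative f' y \<omega>) (at y) \<and> \<bar>f' y \<omega>\<bar> \<le> B \<omega>"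
        \<comment> \<open>The mean value inequality turns the bound \<open>B\<close> on the
          derivative into the same bound on the difference quotients.\<close>
        have "norm (f (X n) \<omega> - f x \<omega>) \<le> B \<omega> * norm (X n - x)"
        proof (rule field_differentiable_bound[of "{a<..<b}" "\<lambda>y. f y \<omega>" "\<lambda>y. f' y \<omega>"])
          show "((\<lambda>y. f y \<omega>) has_real_derivative f' y \<omega>) (at y within {a<..<b})"
            "norm (f' y \<omega>) \<le> B \<omega>" if "y \<in> {a<..<b}" for y
            using * that by (simp_all add: has_field_derivative_at_within)
        qed (use X(1) x in simp_all)
        then show "norm ((f (X n) \<omega> - f x \<omega>) / (X n - x)) \<le> B \<omega>"
          using X(1)[rule_format, of n] by (simp add: pos_divide_le_eq)
      qed
    qed
    have eq: "(\<integral>\<omega>. (f (X n) \<omega> - f x \<omega>) / (X n - x) \<partial>M)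
        = ((\<integral>\<omega>. f (X n) \<omega> \<partial>M) - (\<integral>\<omega>. f x \<omega> \<partial>M)) / (X n - x)" for n
      unfolding integral_divide_zero Bochner_Integration.integral_diff[OF intX int[OF x]] ..
    show "((\<lambda>y. ((\<integral>\<omega>. f y \<omega> \<partial>M) - (\<integral>\<omega>. f x \<omega> \<partial>M)) / (y - x)) \<circ> X) \<longlonglongrightarrow> (\<integral>\<omega>. f' x \<omega> \<partial>M)"
      using * unfolding eq o_def .
  qed
  then show ?thesis
    unfolding at_within_open[OF x open_greaterThanLessThan] by (rule has_field_derivative_iff[THEN iffD2])
qed

lemma lipschitz_abs_continuous:
  assumes "\<And>x y. x \<in> {a..b} \<Longrightarrow> y \<in> {a..b} \<Longrightarrow> \<bar>f x - f y\<bar> \<le> L * \<bar>x - y\<bar>"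
  shows "abs_continuous_on_interval a b f"
  unfolding abs_continuous_on_interval_def
proof (intro allI impI)
  fix e :: real assume e: "0 < e"
  show "\<exists>d>0. \<forall>(n::nat) u v. (\<forall>i<n. a \<le> u i \<and> u i \<le> v i \<and> v i \<le> b) \<longrightarrow>
        disjoint_family_on (\<lambda>i. {u i<..<v i}) {..<n} \<longrightarrow>
        (\<Sum>i<n. v i - u i) < d \<longrightarrow> (\<Sum>i<n. \<bar>f (v i) - f (u i)\<bar>) < e"
  \<comment> \<open>Adding 1 keeps the denominator positive even for L = 0.\<close>
  proof (intro exI[of _ "e / (\<bar>L\<bar> + 1)"] conjI allI impI)
    fix n :: nat and u v :: "nat \<Rightarrow> real"
    assume uv: "\<forall>i<n. a \<le> u i \<and> u i \<le> v i \<and> v i \<le> b" and s: "(\<Sum>i<n. v i - u i) < e / (\<bar>L\<bar> + 1)"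
    have "(\<Sum>i<n. \<bar>f (v i) - f (u i)\<bar>) \<le> (\<Sum>i<n. (\<bar>L\<bar> + 1) * (v i - u i))"
    proof (rule sum_mono)
      fix i assume "i \<in> {..<n}"
      then have i: "a \<le> u i" "u i \<le> v i" "v i \<le> b" using uv by auto
      then have "\<bar>f (v i) - f (u i)\<bar> \<le> L * \<bar>v i - u i\<bar>" by (intro assms) auto
      also have "\<dots> \<le> (\<bar>L\<bar> + 1) * (v i - u i)" using i by (auto intro!: mult_right_mono)
      finally show "\<bar>f (v i) - f (u i)\<bar> \<le> (\<bar>L\<bar> + 1) * (v i - u i)" .
    qed
    also have "\<dots> = (\<bar>L\<bar> + 1) * (\<Sum>i<n. v i - u i)" by (simp add: sum_distrib_left)
    also have "\<dots> < e" using s by (simp add: field_simps)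
    finally show "(\<Sum>i<n. \<bar>f (v i) - f (u i)\<bar>) < e" .
  qed (use e in auto)
qed

text \<open>The factor (r - 1) / x - \<kappa> is the logarithmic derivative. Keeping the density
  itself as a factor lets \<open>gamma_density_le\<close> be reused for the derivative.\<close>

lemma gamma_density_has_derivative:
  assumes "0 < x"
  shows "(gamma_density \<kappa> r has_real_derivative gamma_density \<kappa> r x * ((r - 1) / x - \<kappa>)) (at x)"
proof -
  let ?f = "\<lambda>x. exp (- \<kappa> * x) * (\<kappa> powr r * x powr (r - 1) * rGamma r)"
  have p: "x powr (r - 1 - 1) = x powr (r - 1) / x"
    using powr_diff[of x "r - 1" 1] assms by simp
  have "((\<lambda>x. exp (- \<kappa> * x)) has_real_derivative exp (- \<kappa> * x) * (- \<kappa>)) (at x)"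
    by (auto intro!: derivative_eq_intros)
  moreover have "((\<lambda>x. \<kappa> powr r * x powr (r - 1) * rGamma r) has_real_derivative
      \<kappa> powr r * ((r - 1) * x powr (r - 1 - 1)) * rGamma r) (at x)"
    using assms by (intro DERIV_cmult_right DERIV_cmult has_real_derivative_powr)
  ultimately have "(?f has_real_derivative exp (- \<kappa> * x) * (- \<kappa>) * (\<kappa> powr r * x powr (r - 1) * rGamma r)
      + \<kappa> powr r * ((r - 1) * x powr (r - 1 - 1)) * rGamma r * exp (- \<kappa> * x)) (at x)"
    by (rule DERIV_mult)
  also have "exp (- \<kappa> * x) * (- \<kappa>) * (\<kappa> powr r * x powr (r - 1) * rGamma r)
      + \<kappa> powr r * ((r - 1) * x powr (r - 1 - 1)) * rGamma r * exp (- \<kappa> * x) = ?f x * ((r - 1) / x - \<kappa>)"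
    unfolding p by (simp add: algebra_simps)
  finally have "(?f has_real_derivative ?f x * ((r - 1) / x - \<kappa>)) (at x)" .
  moreover have "eventually (\<lambda>y. gamma_density \<kappa> r y = ?f y) (nhds x)"
    by (rule eventually_mono[OF eventually_nhds_in_open[OF open_greaterThan[of 0]]])
      (use assms in \<open>simp_all add: gamma_density_def\<close>)
  moreover have "gamma_density \<kappa> r x = ?f x" using assms by (simp add: gamma_density_def)
  ultimately show ?thesis
    by (subst DERIV_cong_ev[OF refl]) auto
qed

section \<open>Termwise differentiation of the series in x\<close>

context shape_mixture
begin

abbreviation jump_power :: "nat \<Rightarrow> real \<Rightarrow> real" where
  "jump_power n \<equiv> convolution_power (jump_density \<kappa> q) (Suc n)"

lemma jump_power_le:
  assumes "0 < x"
  shows "jump_power n x \<le> 2 * exp 2 * (max 1 \<kappa> * max 1 x) ^ Suc n / x"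
  using nn_integral_gamma_density_le[OF assms, of n] assms
  by (simp flip: convolution_power_eq_nn_integral add: ennreal_le_iff)

lemma integrable_gamma_density: "integrable (shape_power n) (\<lambda>r. gamma_density \<kappa> r x)"
proof (rule integrableI_bounded)
  have "(\<integral>\<^sup>+r. ennreal (norm (gamma_density \<kappa> r x)) \<partial>shape_power n) = (\<integral>\<^sup>+r. ennreal (gamma_density \<kappa> r x) \<partial>shape_power n)"
    using AE_shape_power[of n]
    by (intro nn_integral_cong_AE, eventually_elim) (simp add: gamma_density_nonneg)
  then show "(\<integral>\<^sup>+r. ennreal (norm (gamma_density \<kappa> r x)) \<partial>shape_power n) < \<infinity>"
    using nn_integral_gamma_density_finite by simp
qed simp

lemma jump_power_eq_integral: "jump_power n x = (\<integral>r. gamma_density \<kappa> r x \<partial>shape_power n)"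
proof -
  have nn: "AE r in shape_power n. 0 \<le> gamma_density \<kappa> r x"
    using AE_shape_power[of n] by eventually_elim (simp add: gamma_density_nonneg)
  have "ennreal (jump_power n x) = ennreal (\<integral>r. gamma_density \<kappa> r x \<partial>shape_power n)"
    unfolding convolution_power_eq_nn_integral[THEN conjunct2]
    by (rule nn_integral_eq_integral[OF integrable_gamma_density nn])
  then show ?thesis
    using convolution_power_nonneg integral_nonneg_AE[OF nn] by (simp add: ennreal_inj)
qed

definition jump_power_deriv :: "nat \<Rightarrow> real \<Rightarrow> real" where
  "jump_power_deriv n x = (\<integral>r. gamma_density \<kappa> r x * ((r - 1) / x - \<kappa>) \<partial>shape_power n)"

text \<open>The product of the bound of \<open>gamma_density_le\<close> on (a, b) with a bound on
  the logarithmic derivative. The latter grows linearly in n; estimating n + 1 by 2^(n + 1) accounts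
  for the factor 2 in the base and keeps the whole bound geometric in n.\<close>

definition deriv_bound :: "real \<Rightarrow> real \<Rightarrow> nat \<Rightarrow> real" where
  "deriv_bound a b n = 2 * exp 2 * (1 / a + \<kappa>) / a * (2 * max 1 \<kappa> * max 1 b) ^ Suc n"

lemma gamma_density_deriv_le:
  assumes "0 < a" "a < x" "x < b" "0 < r" "r < real (Suc n)"
  shows "\<bar>gamma_density \<kappa> r x * ((r - 1) / x - \<kappa>)\<bar> \<le> deriv_bound a b n"
proof -
  have "gamma_density \<kappa> r x \<le> 2 * exp 2 * (max 1 \<kappa> * max 1 x) ^ Suc n / x"
    using assms rate_pos by (intro gamma_density_le) auto
  also have "\<dots> \<le> 2 * exp 2 * (max 1 \<kappa> * max 1 b) ^ Suc n / a"
    using assms by (intro frac_le mult_left_mono power_mono mult_mono) auto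
  finally have 1: "gamma_density \<kappa> r x \<le> \<dots>" .
  have "\<bar>(r - 1) / x - \<kappa>\<bar> \<le> \<bar>r - 1\<bar> / x + \<kappa>"
    using abs_triangle_ineq4[of "(r - 1) / x" \<kappa>] assms rate_pos by (simp add: abs_divide)
  also have "\<dots> \<le> real (Suc n) / a + \<kappa>"
    using assms by (intro add_right_mono frac_le) auto
  also have "\<dots> \<le> real (Suc n) * (1 / a + \<kappa>)"
    using assms rate_pos by (simp add: distrib_left)
  also have "\<dots> \<le> 2 ^ Suc n * (1 / a + \<kappa>)"
    using assms rate_pos of_nat_less_two_power[of "Suc n", where 'a = real]
    by (intro mult_right_mono) (auto simp del: power_Suc of_nat_Suc intro: less_imp_le)
  finally have 2: "\<bar>(r - 1) / x - \<kappa>\<bar> \<le> \<dots>" .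
  have "\<bar>gamma_density \<kappa> r x * ((r - 1) / x - \<kappa>)\<bar>
      \<le> (2 * exp 2 * (max 1 \<kappa> * max 1 b) ^ Suc n / a) * (2 ^ Suc n * (1 / a + \<kappa>))"
    unfolding abs_mult using 1 2 assms rate_pos
    by (intro mult_mono) (auto simp: gamma_density_nonneg intro!: mult_nonneg_nonneg divide_nonneg_pos)
  also have "\<dots> = deriv_bound a b n"
    by (simp add: deriv_bound_def power_mult_distrib)
  finally show ?thesis .
qed

lemma jump_power_has_derivative:
  assumes "0 < x"
  shows "(jump_power n has_real_derivative jump_power_deriv n x) (at x)"
proof -
  have "((\<lambda>x. \<integral>r. gamma_density \<kappa> r x \<partial>shape_power n) has_real_derivative
      (\<integral>r. gamma_density \<kappa> r x * ((r - 1) / x - \<kappa>) \<partial>shape_power n)) (at x)"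
  \<comment> \<open>The neighbourhood (x/2, x + 1) stays away from 0, so a constant dominates, and
    constants are integrable for a probability measure.\<close>
  proof (rule has_real_derivative_lebesgue_integral[where a = "x / 2" and b = "x + 1" and B = "\<lambda>_. deriv_bound (x / 2) (x + 1) n"])
    show "AE r in shape_power n. \<forall>y\<in>{x / 2<..<x + 1}.
        (gamma_density \<kappa> r has_real_derivative gamma_density \<kappa> r y * ((r - 1) / y - \<kappa>)) (at y) \<and>
        \<bar>gamma_density \<kappa> r y * ((r - 1) / y - \<kappa>)\<bar> \<le> deriv_bound (x / 2) (x + 1) n"
      using AE_shape_power[of n]
    proof eventually_elim
      fix r :: real assume "0 < r \<and> r < real (Suc n)"
      then show "\<forall>y\<in>{x / 2<..<x + 1}.
        (gamma_density \<kappa> r has_real_derivative gamma_density \<kappa> r y * ((r - 1) / y - \<kappa>)) (at y) \<and>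
        \<bar>gamma_density \<kappa> r y * ((r - 1) / y - \<kappa>)\<bar> \<le> deriv_bound (x / 2) (x + 1) n"
        using assms by (intro ballI conjI gamma_density_has_derivative gamma_density_deriv_le) auto
    qed
  qed (use assms in \<open>auto intro: integrable_gamma_density\<close>)
  then show ?thesis
    by (simp add: jump_power_eq_integral[abs_def] jump_power_deriv_def)
qed

lemma jump_power_deriv_le:
  assumes "0 < a" "a < x" "x < b"
  shows "\<bar>jump_power_deriv n x\<bar> \<le> deriv_bound a b n"
proof -
  \<comment> \<open>Any admissible shape, here 1/2, exhibits the constant as an upper bound of an
    absolute value.\<close>
  have nn: "0 \<le> deriv_bound a b n"
    using gamma_density_deriv_le[OF assms, of "1/2" n] by auto
  have le: "AE r in shape_power n. \<bar>gamma_density \<kappa> r x * ((r - 1) / x - \<kappa>)\<bar> \<le> deriv_bound a b n"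
    using AE_shape_power[of n] by eventually_elim (rule gamma_density_deriv_le[OF assms], blast+)
  have int: "integrable (shape_power n) (\<lambda>r. gamma_density \<kappa> r x * ((r - 1) / x - \<kappa>))"
  proof (rule Bochner_Integration.integrable_bound[of _ "\<lambda>_. deriv_bound a b n"])
    show "AE r in shape_power n. norm (gamma_density \<kappa> r x * ((r - 1) / x - \<kappa>)) \<le> norm (deriv_bound a b n)"
      using le by eventually_elim (use nn in simp)
  qed simp_all
  have "\<bar>jump_power_deriv n x\<bar> \<le> (\<integral>r. \<bar>gamma_density \<kappa> r x * ((r - 1) / x - \<kappa>)\<bar> \<partial>shape_power n)"
    unfolding jump_power_deriv_def by (rule integral_abs_bound)
  also have "\<dots> \<le> (\<integral>r. deriv_bound a b n \<partial>shape_power n)"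
    by (rule integral_mono_AE[OF integrable_abs[OF int] _ le]) simp
  finally show ?thesis by (simp add: shape_power.prob_space)
qed

lemma summable_poisson_weights:
  fixes t c :: real
  shows "summable (\<lambda>n. t ^ Suc n / fact (Suc n) * c ^ Suc n)"
proof -
  have "summable (\<lambda>n. (t * c) ^ n / fact n)"
    using summable_exp[of "t * c"] by (simp add: divide_inverse mult.commute)
  then have "summable (\<lambda>n. (t * c) ^ Suc n / fact (Suc n))"
    by (subst summable_Suc_iff)
  then show ?thesis by (simp add: power_mult_distrib mult_ac)
qed

lemma summable_compound:
  assumes "0 \<le> t"
  shows "summable (\<lambda>n. t ^ Suc n / fact (Suc n) * jump_power n x)"
proof (cases "0 < x")
  case True
  have "summable (\<lambda>n. 2 * exp 2 / x * (t ^ Suc n / fact (Suc n) * (max 1 \<kappa> * max 1 x) ^ Suc n))"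
    by (intro summable_mult summable_poisson_weights)
  then show ?thesis
  proof (rule summable_comparison_test'[of _ 0])
    fix n :: nat
    have "t ^ Suc n / fact (Suc n) * jump_power n x \<le> t ^ Suc n / fact (Suc n) * (2 * exp 2 * (max 1 \<kappa> * max 1 x) ^ Suc n / x)"
      using assms True by (intro mult_left_mono jump_power_le) auto
    then show "norm (t ^ Suc n / fact (Suc n) * jump_power n x) \<le> 2 * exp 2 / x * (t ^ Suc n / fact (Suc n) * (max 1 \<kappa> * max 1 x) ^ Suc n)"
      using assms convolution_power_nonneg[of n x] by (simp add: abs_mult mult_ac)
  qed
qed (simp add: convolution_power_eq_0)

abbreviation cdens :: "real \<Rightarrow> real \<Rightarrow> real" where
  "cdens \<equiv> compound_density (jump_density \<kappa> q)"

text \<open>The Weierstrass test with \<open>deriv_bound\<close> against the Poisson weights. The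
  single bound L for the whole interval yields both differentiability and, through the Lipschitz
  property, local absolute continuity.\<close>

lemma compound_density_has_bounded_derivative:
  assumes "0 \<le> t" "0 < a" "a < b"
  obtains L where "\<And>x. x \<in> {a<..<b} \<Longrightarrow> \<exists>D. ((\<lambda>x. cdens x t) has_real_derivative D) (at x) \<and> \<bar>D\<bar> \<le> L"
proof -
  let ?w = "\<lambda>n. t ^ Suc n / fact (Suc n)"
  let ?C = "\<lambda>n. ?w n * deriv_bound a b n"
  have w: "0 \<le> ?w n" for n using assms by simp
  have C: "summable ?C"
  proof -
    have "summable (\<lambda>n. 2 * exp 2 * (1 / a + \<kappa>) / a * (?w n * (2 * max 1 \<kappa> * max 1 b) ^ Suc n))"
      by (intro summable_mult summable_poisson_weights)
    then show ?thesis by (simp add: deriv_bound_def mult_ac)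
  qed
  have bound: "norm (?w n * jump_power_deriv n x) \<le> ?C n" if "x \<in> {a<..<b}" for n x
    using mult_left_mono[OF jump_power_deriv_le[of a x b n] w[of n]] that assms w[of n]
    by (simp add: abs_mult del: power_Suc fact_Suc)
  have unif: "uniformly_convergent_on {a<..<b} (\<lambda>n x. \<Sum>i<n. ?w i * jump_power_deriv i x)"
    by (rule Weierstrass_m_test'[OF bound C])
  show thesis
  proof (rule that[of "exp (- t) * (\<Sum>n. ?C n)"])
    fix x assume x: "x \<in> {a<..<b}"
    have "((\<lambda>x. \<Sum>n. ?w n * jump_power n x) has_real_derivative (\<Sum>n. ?w n * jump_power_deriv n x)) (at x)"
    proof (rule has_field_derivative_series'(2)[OF _ _ unif x])
      show "((\<lambda>x. ?w n * jump_power n x) has_real_derivative ?w n * jump_power_deriv n y) (at y within {a<..<b})"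
        if "y \<in> {a<..<b}" for n y
        using that assms
        by (intro DERIV_cmult has_field_derivative_at_within[OF jump_power_has_derivative]) auto
      show "summable (\<lambda>n. ?w n * jump_power n x)"
        by (rule summable_compound[OF assms(1)])
    qed (use x in \<open>auto simp: interior_open\<close>)
    from DERIV_cmult[OF this, of "exp (- t)"]
    have "((\<lambda>x. cdens x t) has_real_derivative exp (- t) * (\<Sum>n. ?w n * jump_power_deriv n x)) (at x)"
      by (simp add: compound_density_def)
    moreover have "\<bar>exp (- t) * (\<Sum>n. ?w n * jump_power_deriv n x)\<bar> \<le> exp (- t) * (\<Sum>n. ?C n)"
      using norm_suminf_le[of "\<lambda>n. ?w n * jump_power_deriv n x" ?C] bound[OF x] C
      by (simp add: abs_mult)
    ultimately show "\<exists>D. ((\<lambda>x. cdens x t) has_real_derivative D) (at x) \<and> \<bar>D\<bar> \<le> exp (- t) * (\<Sum>n. ?C n)"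
      by blast
  qed
qed

lemma compound_density_differentiable:
  assumes "0 \<le> t"
  shows "(\<lambda>x. cdens x t) differentiable_on {0<..}"
  unfolding differentiable_on_def
proof
  fix x :: real assume x: "x \<in> {0<..}"
  then obtain L where "\<And>y. y \<in> {x/2<..<x+1} \<Longrightarrow> \<exists>D. ((\<lambda>x. cdens x t) has_real_derivative D) (at y) \<and> \<bar>D\<bar> \<le> L"
    using compound_density_has_bounded_derivative[OF assms, of "x / 2" "x + 1"] by auto
  from this[of x] obtain D where "((\<lambda>x. cdens x t) has_real_derivative D) (at x)"
    using x by auto
  then show "(\<lambda>x. cdens x t) differentiable at x within {0<..}"
    by (auto simp: has_field_derivative_def intro: differentiableI differentiable_at_withinI)
qed

lemma compound_density_AC_loc_pos:
  assumes "0 \<le> t"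
  shows "AC_loc_pos (\<lambda>x. cdens x t)"
  unfolding AC_loc_pos_def
proof (intro allI impI)
  fix a b :: real assume ab: "0 < a" "a < b"
  then obtain L where L: "\<And>y. y \<in> {a/2<..<b+1} \<Longrightarrow> \<exists>D. ((\<lambda>x. cdens x t) has_real_derivative D) (at y) \<and> \<bar>D\<bar> \<le> L"
    using compound_density_has_bounded_derivative[OF assms, of "a / 2" "b + 1"] by auto
  then obtain D where D: "\<And>y. y \<in> {a/2<..<b+1} \<Longrightarrow> ((\<lambda>x. cdens x t) has_real_derivative D y) (at y) \<and> \<bar>D y\<bar> \<le> L"
    by metis
  show "abs_continuous_on_interval a b (\<lambda>x. cdens x t)"
  proof (rule lipschitz_abs_continuous[of _ _ _ L])
    fix x y assume "x \<in> {a..b}" "y \<in> {a..b}"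
    then have "norm (cdens x t - cdens y t) \<le> L * norm (x - y)"
      using ab D
      by (intro field_differentiable_bound[of "{a/2<..<b+1}" _ D])
        (auto intro: has_field_derivative_at_within)
    then show "\<bar>cdens x t - cdens y t\<bar> \<le> L * \<bar>x - y\<bar>" by simp
  qed
qed

end

subsection \<open>The operator as convolution with the jump density\<close>

text \<open>A derivative existing everywhere is integrable in the Henstock-Kurzweil sense by the
  fundamental theorem, but not necessarily absolutely. Bounded variation repairs this: on a division
  the norms of the integrals of f' are exactly the increments of f, which \<open>var\<close>
  bounds.\<close>

lemma absolutely_integrable_of_small_variation:
  fixes f f' :: "real \<Rightarrow> real"
  assumes ftc: "\<And>u v. c \<le> u \<Longrightarrow> u \<le> v \<Longrightarrow> v \<le> d \<Longrightarrow> (f' has_integral (f v - f u)) {u..v}"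
    and "c \<le> d"
    and var: "\<And>(n::nat) u v. (\<And>i. i < n \<Longrightarrow> c \<le> u i \<and> u i \<le> v i \<and> v i \<le> d) \<Longrightarrow>
        disjoint_family_on (\<lambda>i. {u i<..<v i}) {..<n} \<Longrightarrow>
        (\<Sum>i<n. v i - u i) \<le> d - c \<Longrightarrow> (\<Sum>i<n. \<bar>f (v i) - f (u i)\<bar>) \<le> B"
  shows "f' absolutely_integrable_on {c..d}"
proof -
  have "f' absolutely_integrable_on cbox c d"
  proof (rule bounded_variation_absolutely_integrable_interval[where B = B])
    show "f' integrable_on cbox c d"
      using ftc[of c d] assms(2) by (auto simp: integrable_on_def)
    fix \<D> assume D: "\<D> division_of cbox c d"
    have fin: "finite \<D>" using D by (rule division_of_finite)
    have "\<exists>u v. K = {u..v} \<and> c \<le> u \<and> u \<le> v \<and> v \<le> d" if K: "K \<in> \<D>" for K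
    proof -
      obtain u v where uv: "K = cbox u v" using division_ofD(4)[OF D K] by blast
      have "K \<noteq> {}" "K \<subseteq> cbox c d" using division_ofD(2,3)[OF D K] by auto
      then show ?thesis unfolding uv by (intro exI[of _ u] exI[of _ v]) auto
    qed
    then obtain lo hi where lh: "\<And>K. K \<in> \<D> \<Longrightarrow> K = {lo K..hi K} \<and> c \<le> lo K \<and> lo K \<le> hi K \<and> hi K \<le> d"
      by metis
    \<comment> \<open>Absolute continuity speaks of finite sequences of intervals, so the division
      is enumerated.\<close>
    obtain h where "bij_betw h {0..<card \<D>} \<D>" using ex_bij_betw_nat_finite[OF fin] by blast
    then have h: "bij_betw h {..<card \<D>} \<D>" by (simp add: atLeast0LessThan)
    have hD: "h i \<in> \<D>" if "i < card \<D>" for i using h that by (auto simp: bij_betw_def)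
    have "(\<Sum>K\<in>\<D>. norm (integral K f')) = (\<Sum>K\<in>\<D>. \<bar>f (hi K) - f (lo K)\<bar>)"
    proof (rule sum.cong[OF refl])
      fix K assume "K \<in> \<D>"
      then have K: "K = {lo K..hi K}" "c \<le> lo K" "lo K \<le> hi K" "hi K \<le> d" using lh by auto
      have "integral {lo K..hi K} f' = f (hi K) - f (lo K)"
        by (rule integral_unique[OF ftc[OF K(2-4)]])
      then show "norm (integral K f') = \<bar>f (hi K) - f (lo K)\<bar>" using K(1) by simp
    qed
    also have "\<dots> = (\<Sum>i<card \<D>. \<bar>f (hi (h i)) - f (lo (h i))\<bar>)"
      by (rule sum.reindex_bij_betw[OF h, symmetric])
    also have "\<dots> \<le> B"
    proof (rule var)
      show "c \<le> lo (h i) \<and> lo (h i) \<le> hi (h i) \<and> hi (h i) \<le> d" if "i < card \<D>" for i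
        using lh[OF hD[OF that]] by blast
      show "disjoint_family_on (\<lambda>i. {lo (h i)<..<hi (h i)}) {..<card \<D>}"
        unfolding disjoint_family_on_def
      proof (intro ballI impI)
        fix i j assume ij: "i \<in> {..<card \<D>}" "j \<in> {..<card \<D>}" "i \<noteq> j"
        then have ne: "h i \<noteq> h j" using h by (auto simp: bij_betw_def inj_on_def)
        have "interior (h i) \<inter> interior (h j) = {}"
          using division_ofD(5)[OF D _ _ ne] hD ij by auto
        moreover have "interior (h i) = {lo (h i)<..<hi (h i)}" "interior (h j) = {lo (h j)<..<hi (h j)}"
          using lh[OF hD[of i]] lh[OF hD[of j]] ij interior_atLeastAtMost_real by (metis lessThan_iff)+
        ultimately show "{lo (h i)<..<hi (h i)} \<inter> {lo (h j)<..<hi (h j)} = {}" by simp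
      qed
      \<comment> \<open>Additivity of length over a division: the intervals together have length d -
        c.\<close>
      have "(\<Sum>i<card \<D>. hi (h i) - lo (h i)) = (\<Sum>K\<in>\<D>. hi K - lo K)"
        by (rule sum.reindex_bij_betw[OF h])
      also have "\<dots> = (\<Sum>K\<in>\<D>. measure lborel K)"
      proof (rule sum.cong[OF refl])
        fix K assume "K \<in> \<D>"
        then have K: "K = {lo K..hi K}" "lo K \<le> hi K" using lh by auto
        show "hi K - lo K = measure lborel K" by (subst K(1)) (use K(2) in simp)
      qed
      also have "\<dots> = measure lborel (cbox c d)" by (rule additive_content_division[OF D])
      finally show "(\<Sum>i<card \<D>. hi (h i) - lo (h i)) \<le> d - c" using assms(2) by simp
    qed
    finally show "(\<Sum>K\<in>\<D>. norm (integral K f')) \<le> B" .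
  qed
  then show ?thesis by simp
qed

text \<open>Absolute continuity with e = 1 bounds the variation by 1 on any interval shorter than
  the corresponding \<delta>; finitely many such intervals cover {a..b}.\<close>

lemma abs_continuous_deriv_absolutely_integrable:
  fixes f f' :: "real \<Rightarrow> real"
  assumes "a \<le> b" and AC: "abs_continuous_on_interval a b f"
    and der: "\<And>z. z \<in> {a..b} \<Longrightarrow> (f has_real_derivative f' z) (at z)"
  shows "f' absolutely_integrable_on {a..b}"
proof -
  have ftc: "(f' has_integral (f v - f u)) {u..v}" if "a \<le> u" "u \<le> v" "v \<le> b" for u v
    using that der
    by (intro fundamental_theorem_of_calculus)
      (auto simp: has_real_derivative_iff_has_vector_derivative[symmetric] intro: has_field_derivative_at_within)
  obtain \<delta> where \<delta>: "0 < \<delta>"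
    and var: "\<forall>(n::nat) u v. (\<forall>i<n. a \<le> u i \<and> u i \<le> v i \<and> v i \<le> b) \<longrightarrow>
        disjoint_family_on (\<lambda>i. {u i<..<v i}) {..<n} \<longrightarrow>
        (\<Sum>i<n. v i - u i) < \<delta> \<longrightarrow> (\<Sum>i<n. \<bar>f (v i) - f (u i)\<bar>) < 1"
    using AC[unfolded abs_continuous_on_interval_def, rule_format, OF zero_less_one] by blast
  have small: "f' absolutely_integrable_on {c..d}" if "a \<le> c" "c \<le> d" "d \<le> b" "d - c < \<delta>" for c d
  proof (rule absolutely_integrable_of_small_variation[where B = 1 and f = f])
    fix n :: nat and u v :: "nat \<Rightarrow> real"
    assume *: "\<And>i. i < n \<Longrightarrow> c \<le> u i \<and> u i \<le> v i \<and> v i \<le> d"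
      and "disjoint_family_on (\<lambda>i. {u i<..<v i}) {..<n}" "(\<Sum>i<n. v i - u i) \<le> d - c"
    moreover have "\<forall>i<n. a \<le> u i \<and> u i \<le> v i \<and> v i \<le> b"
      using * that by (meson order_trans)
    ultimately show "(\<Sum>i<n. \<bar>f (v i) - f (u i)\<bar>) \<le> 1"
      using var[rule_format, of n u v] that by simp
  qed (use that ftc in auto)
  \<comment> \<open>Enough equal pieces for each to be shorter than \<delta>.\<close>
  obtain m where m: "(b - a) / \<delta> < real m" using reals_Archimedean2 by blast
  have m0: "0 < real m" using m \<delta> assms(1) by (meson divide_nonneg_pos diff_ge_0_iff_ge le_less_trans)
  define h where "h = (b - a) / real m"
  have h: "0 \<le> h" "h < \<delta>" "real m * h = b - a"
    using m m0 \<delta> assms(1) by (auto simp: h_def field_simps)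
  have "j \<le> m \<Longrightarrow> f' absolutely_integrable_on {a..a + real j * h}" for j
  proof (induction j)
    case 0
    show ?case using small[of a a] assms(1) \<delta> by simp
  next
    case (Suc j)
    have le: "real (Suc j) * h \<le> b - a"
      unfolding h(3)[symmetric] using Suc.prems h(1) by (intro mult_right_mono) auto
    have s: "a + real (Suc j) * h = (a + real j * h) + h" by (simp add: algebra_simps)
    have "f' absolutely_integrable_on ({a..a + real j * h} \<union> {a + real j * h..a + real (Suc j) * h})"
    proof (rule set_integrable_Un)
      show "f' absolutely_integrable_on {a..a + real j * h}" using Suc by simp
      show "f' absolutely_integrable_on {a + real j * h..a + real (Suc j) * h}"
        using le h(1,2) unfolding s by (intro small) (auto simp: algebra_simps)
    qed auto
    also have "{a..a + real j * h} \<union> {a + real j * h..a + real (Suc j) * h} = {a..a + real (Suc j) * h}"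
      using h(1) unfolding s by (intro ivl_disj_un_two_touch) auto
    finally show ?case .
  qed
  from this[of m] show ?thesis by (simp add: h(3))
qed

lemma differentiable_on_pos_has_derivative:
  fixes f :: "real \<Rightarrow> real"
  assumes "f differentiable_on {0<..}" "0 < z"
  shows "(f has_real_derivative deriv f z) (at z)"
proof -
  have "f differentiable (at z)"
    using assms unfolding differentiable_on_def
    by (metis at_within_open greaterThan_iff open_greaterThan)
  then show ?thesis using DERIV_deriv_iff_real_differentiable by blast
qed

text \<open>A pointwise limit of difference quotients with steps 1/(n + 1). Only steps to the right
  occur, so cutting f off at 0 does not disturb the quotients at z > 0.\<close>

lemma deriv_borel_measurable:
  assumes "f differentiable_on {0<..}"
  shows "(\<lambda>z. indicator {0<..} z * deriv f z) \<in> borel_measurable (borel :: real measure)"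
proof (rule borel_measurable_LIMSEQ_real)
  define F where "F = (\<lambda>z. indicator {0<..} z *\<^sub>R f z)"
  have "continuous_on {0<..} f" by (rule differentiable_imp_continuous_on[OF assms])
  then have [measurable]: "F \<in> borel_measurable borel"
    unfolding F_def by (intro borel_measurable_continuous_on_indicator) auto
  show "(\<lambda>z. indicator {0<..} z * ((F (z + 1 / Suc n) - F z) / (1 / Suc n))) \<in> borel_measurable borel" for n
    by measurable
  fix z :: real
  show "(\<lambda>n. indicator {0<..} z * ((F (z + 1 / Suc n) - F z) / (1 / Suc n))) \<longlonglongrightarrow> indicator {0<..} z * deriv f z"
  proof (cases "0 < z")
    case True
    from differentiable_on_pos_has_derivative[OF assms this] have "((\<lambda>h. (f (z + h) - f z) / h) \<longlongrightarrow> deriv f z) (at 0)"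
      by (simp add: DERIV_def)
    moreover have "filterlim (\<lambda>n. 1 / real (Suc n)) (at 0) sequentially"
      unfolding filterlim_at using LIMSEQ_Suc[OF lim_1_over_n] by (auto simp: lim_1_over_n)
    ultimately have "(\<lambda>n. (f (z + 1 / Suc n) - f z) / (1 / Suc n)) \<longlonglongrightarrow> deriv f z"
      by (rule filterlim_compose)
    moreover have "F (z + 1 / Suc n) = f (z + 1 / Suc n)" "F z = f z" for n
      using True by (auto simp: F_def add_pos_pos)
    ultimately show ?thesis using True by simp
  qed simp
qed

text \<open>\<open>absolutely_integrable_on\<close> refers to the completed measure; Borel
  measurability of the derivative brings the result back to \<open>lborel\<close>.\<close>

lemma set_integrable_deriv:
  assumes diff: "f differentiable_on {0<..}" and AC: "AC_loc_pos f" and "0 < a" "a < b"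
  shows "set_integrable lborel {a..b} (deriv f)"
proof -
  have "(f has_real_derivative deriv f z) (at z)" if "z \<in> {a..b}" for z
    using that assms(3) by (intro differentiable_on_pos_has_derivative[OF diff]) auto
  then have "deriv f absolutely_integrable_on {a..b}"
    using AC assms(3,4) unfolding AC_loc_pos_def
    by (intro abs_continuous_deriv_absolutely_integrable[where f = f]) auto
  then have int: "integrable (completion lborel) (\<lambda>z. indicator {a..b} z *\<^sub>R deriv f z)"
    by (simp add: set_integrable_def)
  note [measurable] = deriv_borel_measurable[OF diff]
  have "(\<lambda>z. indicator {a..b} z * (indicator {0<..} z * deriv f z)) \<in> borel_measurable lborel"
    by measurable
  moreover have "(\<lambda>z. indicator {a..b} z * (indicator {0<..} z * deriv f z)) = (\<lambda>z. indicator {a..b} z *\<^sub>R deriv f z)"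
    using assms(3) by (auto simp: indicator_def fun_eq_iff)
  ultimately have "(\<lambda>z. indicator {a..b} z *\<^sub>R deriv f z) \<in> borel_measurable lborel" by simp
  from integrable_completion[OF this] int show ?thesis by (simp add: set_integrable_def)
qed

lemma set_integrable_mult_bounded:
  fixes f h :: "'a \<Rightarrow> real"
  assumes f: "set_integrable M A f" and h: "(\<lambda>x. indicator A x *\<^sub>R h x) \<in> borel_measurable M"
    and B: "\<And>x. x \<in> A \<Longrightarrow> \<bar>h x\<bar> \<le> B"
  shows "set_integrable M A (\<lambda>x. f x * h x)"
proof -
  let ?f = "\<lambda>x. indicator A x *\<^sub>R f x" and ?h = "\<lambda>x. indicator A x *\<^sub>R h x"
  have int: "integrable M ?f" using f by (simp add: set_integrable_def)
  have "integrable M (\<lambda>x. ?f x * ?h x)"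
  proof (rule Bochner_Integration.integrable_bound)
    show "integrable M (\<lambda>x. B * ?f x)" using int by (rule integrable_mult_right)
    show "(\<lambda>x. ?f x * ?h x) \<in> borel_measurable M"
      using borel_measurable_integrable[OF int] h by (rule borel_measurable_times)
    have "\<bar>f x\<bar> * \<bar>h x\<bar> \<le> \<bar>B\<bar> * \<bar>f x\<bar>" if "x \<in> A" for x
      using B[OF that] by (subst mult.commute) (auto intro!: mult_right_mono)
    then show "AE x in M. norm (?f x * ?h x) \<le> norm (B * ?f x)"
      by (auto simp: indicator_def abs_mult)
  qed
  moreover have "(\<lambda>x. ?f x * ?h x) = (\<lambda>x. indicator A x *\<^sub>R (f x * h x))"
    by (auto simp: indicator_def)
  ultimately show ?thesis by (simp add: set_integrable_def)
qed

section \<open>The kernel as an antiderivative, and integration by parts\<close>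

context shape_mixture
begin

lemma integrable_jump_density: "integrable lborel (jump_density \<kappa> q)"
  by (rule nn_integral_eq_integral_finite(1)) (auto simp: jump_density_nonneg jump_density_mass)

lemma conv_kernel_le_1:
  assumes "0 \<le> y"
  shows "\<bar>conv_kernel \<kappa> q y\<bar> \<le> 1"
proof -
  have "ennreal (conv_kernel \<kappa> q y) \<le> (\<integral>\<^sup>+u. ennreal (jump_density \<kappa> q u) \<partial>lborel)"
    unfolding conv_kernel_eq_tail(2)[OF assms]
    by (intro nn_integral_mono) (auto simp: indicator_def)
  then show ?thesis
    unfolding jump_density_mass using conv_kernel_eq_tail(1)[OF assms] by simp
qed

lemma conv_kernel_0: "conv_kernel \<kappa> q 0 = 1"
proof -
  have "ennreal (conv_kernel \<kappa> q 0) = (\<integral>\<^sup>+u. ennreal (jump_density \<kappa> q u) \<partial>lborel)"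
    unfolding conv_kernel_eq_tail(2)[OF order_refl]
    by (intro nn_integral_cong) (auto simp: indicator_def jump_density_def)
  then show ?thesis by (simp add: jump_density_mass)
qed

lemma set_integrable_jump_density:
  assumes "A \<in> sets borel"
  shows "set_integrable lborel A (jump_density \<kappa> q)"
  unfolding set_integrable_def using integrable_jump_density assms
  by (intro integrable_mult_indicator) auto

lemma conv_kernel_has_integral:
  assumes "0 \<le> y"
  shows "(jump_density \<kappa> q has_integral conv_kernel \<kappa> q y) {y..}"
proof -
  have int: "set_integrable lborel {y..} (jump_density \<kappa> q)"
    by (rule set_integrable_jump_density) simp
  have "ennreal (LBINT u:{y..}. jump_density \<kappa> q u) = (\<integral>\<^sup>+u. ennreal (indicator {y..} u *\<^sub>R jump_density \<kappa> q u) \<partial>lborel)"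
    unfolding set_lebesgue_integral_def using int jump_density_nonneg
    by (subst nn_integral_eq_integral) (auto simp: set_integrable_def)
  also have "\<dots> = ennreal (conv_kernel \<kappa> q y)"
    unfolding conv_kernel_eq_tail(2)[OF assms] by (intro nn_integral_cong) (auto simp: indicator_def)
  finally have "(LBINT u:{y..}. jump_density \<kappa> q u) = conv_kernel \<kappa> q y"
    using conv_kernel_eq_tail(1)[OF assms] jump_density_nonneg
    by (subst (asm) ennreal_inj)
      (auto simp: set_lebesgue_integral_def intro!: Bochner_Integration.integral_nonneg)
  then show ?thesis
    using set_borel_integral_eq_integral[OF int] by (metis integrable_integral)
qed

lemma conv_kernel_eq_integral:
  assumes "0 \<le> a" "a \<le> b"
  shows "conv_kernel \<kappa> q b = conv_kernel \<kappa> q a - integral {a..b} (jump_density \<kappa> q)"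
proof -
  have "jump_density \<kappa> q integrable_on {a..b}"
    by (rule set_borel_integral_eq_integral(1)[OF set_integrable_jump_density]) simp
  then have "(jump_density \<kappa> q has_integral (integral {a..b} (jump_density \<kappa> q) + conv_kernel \<kappa> q b)) ({a..b} \<union> {b..})"
    using assms by (intro has_integral_Un integrable_integral conv_kernel_has_integral) auto
  moreover have "{a..b} \<union> {b..} = {a..}" using assms by auto
  ultimately have "integral {a..b} (jump_density \<kappa> q) + conv_kernel \<kappa> q b = conv_kernel \<kappa> q a"
    using conv_kernel_has_integral[OF assms(1)] by (metis has_integral_unique)
  then show ?thesis by simp
qed

text \<open>Continuity up to and including 0 is wanted, where the derivative, minus the jump
  density, is out of control. It follows from continuity of an indefinite integral.\<close>

lemma conv_kernel_continuous: "continuous_on {0..x} (conv_kernel \<kappa> q)"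
proof -
  have "jump_density \<kappa> q integrable_on {0..x}"
    by (rule set_borel_integral_eq_integral(1)[OF set_integrable_jump_density]) simp
  then have "continuous_on {0..x} (\<lambda>y. conv_kernel \<kappa> q 0 - integral {0..y} (jump_density \<kappa> q))"
    by (intro continuous_intros indefinite_integral_continuous_1)
  then show ?thesis
  proof (rule continuous_on_eq)
    show "conv_kernel \<kappa> q 0 - integral {0..y} (jump_density \<kappa> q) = conv_kernel \<kappa> q y" if "y \<in> {0..x}" for y
      using conv_kernel_eq_integral[of 0 y] that by simp
  qed
qed

lemma conv_kernel_has_derivative:
  assumes "0 < y"
  shows "(conv_kernel \<kappa> q has_real_derivative - jump_density \<kappa> q y) (at y)"
proof -
  let ?g = "jump_density \<kappa> q"
  have dg: "(?g has_real_derivative jump_power_deriv 0 x) (at x)" if "0 < x" for x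
    using jump_power_has_derivative[OF that, of 0] by (simp add: convolution_power_def)
  have "continuous_on {y/2..y+1} ?g"
    using assms by (intro continuous_at_imp_continuous_on ballI DERIV_isCont[OF dg]) auto
  then have "((\<lambda>x. integral {y/2..x} ?g) has_real_derivative ?g y) (at y within {y/2..y+1})"
    using assms by (intro integral_has_real_derivative) auto
  then have "((\<lambda>x. conv_kernel \<kappa> q (y/2) - integral {y/2..x} ?g) has_real_derivative 0 - ?g y) (at y within {y/2..y+1})"
    by (intro derivative_intros)
  then have "((\<lambda>x. conv_kernel \<kappa> q (y/2) - integral {y/2..x} ?g) has_real_derivative - ?g y) (at y within {y/2..y+1})"
    by simp
  then have "(conv_kernel \<kappa> q has_real_derivative - ?g y) (at y within {y/2..y+1})"
  proof (rule has_field_derivative_transform_within[OF _ zero_less_one])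
    show "conv_kernel \<kappa> q (y/2) - integral {y/2..x} ?g = conv_kernel \<kappa> q x" if "x \<in> {y/2..y+1}" for x
      using conv_kernel_eq_integral[of "y/2" x] that assms by simp
  qed (use assms in simp)
  moreover have "y \<in> interior {y/2..y+1}" using assms by (simp add: interior_atLeastAtMost_real)
  ultimately show ?thesis by (metis at_within_interior)
qed

text \<open>The singularity of the jump density sits at z = x and is integrable; f is bounded on the
  compact interval.\<close>

lemma set_integrable_mult_jump_density:
  assumes cf: "continuous_on {\<epsilon>..x} f"
  shows "set_integrable lborel {\<epsilon>..x} (\<lambda>z. f z * jump_density \<kappa> q (x - z))"
proof -
  obtain B where "\<forall>y\<in>f ` {\<epsilon>..x}. norm y \<le> B"
    using compact_imp_bounded[OF compact_continuous_image[OF cf compact_Icc]] unfolding bounded_iff by blast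
  then have B: "\<bar>f z\<bar> \<le> B" if "z \<in> {\<epsilon>..x}" for z
    using that by simp
  have "set_integrable lborel {\<epsilon>..x} (\<lambda>z. jump_density \<kappa> q (x - z))"
    unfolding set_integrable_def
    using lborel_integrable_real_affine[OF integrable_jump_density, of "-1" x]
    by (intro integrable_mult_indicator) auto
  then have "set_integrable lborel {\<epsilon>..x} (\<lambda>z. jump_density \<kappa> q (x - z) * f z)"
    using B borel_measurable_continuous_on_indicator[OF _ cf]
    by (intro set_integrable_mult_bounded) auto
  then show ?thesis by (simp add: mult.commute)
qed

text \<open>Integration by parts, with \<open>conv_kernel\<close> as the antiderivative of minus the jump
  density; the two boundary terms at \<open>\<epsilon>\<close> cancel.\<close>

lemma conv_deriv_trunc_eq:
  assumes diff: "f differentiable_on {0<..}" and AC: "AC_loc_pos f" and e: "0 < \<epsilon>" "\<epsilon> < x"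
  shows "conv_deriv_trunc \<kappa> q f x \<epsilon> = f x - (LBINT z:{\<epsilon>..x}. f z * jump_density \<kappa> q (x - z))"
proof -
  let ?K = "conv_kernel \<kappa> q" and ?g = "jump_density \<kappa> q"
  have [measurable]: "?K \<in> borel_measurable borel"
    by (rule conv_kernel_measurable[OF q_measurable])
  note df = differentiable_on_pos_has_derivative[OF diff]
  have cf: "continuous_on {\<epsilon>..x} f"
    using e by (intro continuous_at_imp_continuous_on ballI DERIV_isCont[OF df]) auto
  have int1: "set_integrable lborel {\<epsilon>..x} (\<lambda>z. deriv f z * ?K (x - z))"
  proof (rule set_integrable_mult_bounded[OF set_integrable_deriv[OF diff AC e]])
    show "\<bar>?K (x - z)\<bar> \<le> 1" if "z \<in> {\<epsilon>..x}" for z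
      using that by (intro conv_kernel_le_1) auto
  qed simp
  note int2 = set_integrable_mult_jump_density[OF cf]
  have "((\<lambda>z. deriv f z * ?K (x - z) + f z * ?g (x - z)) has_integral (f x * ?K (x - x) - f \<epsilon> * ?K (x - \<epsilon>))) {\<epsilon>..x}"
  \<comment> \<open>The interior form is used because at z = x the kernel is evaluated at 0, where
    it is known to be continuous only.\<close>
  proof (rule fundamental_theorem_of_calculus_interior)
    have "continuous_on {\<epsilon>..x} (\<lambda>z. ?K (x - z))"
      using e by (intro continuous_on_compose2[OF conv_kernel_continuous[of x]] continuous_intros) auto
    then show "continuous_on {\<epsilon>..x} (\<lambda>z. f z * ?K (x - z))"
      using cf by (intro continuous_intros)
    fix z assume z: "z \<in> {\<epsilon><..<x}"
    have "((\<lambda>z. ?K (x - z)) has_real_derivative - ?g (x - z) * (0 - 1)) (at z)"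
      using z by (intro DERIV_chain2[OF conv_kernel_has_derivative] derivative_intros) auto
    then have "((\<lambda>z. f z * ?K (x - z)) has_real_derivative deriv f z * ?K (x - z) + (- ?g (x - z) * (0 - 1)) * f z) (at z)"
      using z e by (intro DERIV_mult df) auto
    then show "((\<lambda>z. f z * ?K (x - z)) has_vector_derivative deriv f z * ?K (x - z) + f z * ?g (x - z)) (at z)"
      by (simp add: has_real_derivative_iff_has_vector_derivative mult.commute)
  qed (use e in simp)
  moreover have "((\<lambda>z. deriv f z * ?K (x - z) + f z * ?g (x - z)) has_integral
      ((LBINT z:{\<epsilon>..x}. deriv f z * ?K (x - z)) + (LBINT z:{\<epsilon>..x}. f z * ?g (x - z)))) {\<epsilon>..x}"
    using set_borel_integral_eq_integral[OF int1] set_borel_integral_eq_integral[OF int2]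
    by (intro has_integral_add) (simp_all add: integrable_integral)
  ultimately have "f x * ?K (x - x) - f \<epsilon> * ?K (x - \<epsilon>)
     = (LBINT z:{\<epsilon>..x}. deriv f z * ?K (x - z)) + (LBINT z:{\<epsilon>..x}. f z * ?g (x - z))"
    by (rule has_integral_unique)
  then show ?thesis by (simp add: conv_deriv_trunc_def conv_kernel_0)
qed

end

subsection \<open>The compound density solves the equation\<close>

context shape_mixture
begin

lemma cdens_nonneg: "0 \<le> t \<Longrightarrow> 0 \<le> cdens x t"
  unfolding compound_density_def
  by (intro mult_nonneg_nonneg suminf_nonneg summable_compound) (auto simp: convolution_power_nonneg)

text \<open>In this form the sum can be exchanged with integrals of nonnegative functions without
  further conditions.\<close>

lemma ennreal_cdens:
  assumes "0 \<le> t"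
  shows "ennreal (cdens x t) = (\<Sum>n. ennreal (exp (- t) * (t ^ Suc n / fact (Suc n))) * ennreal (jump_power n x))"
proof -
  let ?a = "\<lambda>n. t ^ Suc n / fact (Suc n) * jump_power n x"
  have s: "summable ?a" by (rule summable_compound[OF assms])
  have "cdens x t = (\<Sum>n. exp (- t) * ?a n)"
    unfolding compound_density_def by (rule suminf_mult[OF s, symmetric])
  also have "ennreal \<dots> = (\<Sum>n. ennreal (exp (- t) * ?a n))"
    using assms by (intro suminf_ennreal2[symmetric] summable_mult s)
      (simp add: convolution_power_nonneg)
  also have "\<dots> = (\<Sum>n. ennreal (exp (- t) * (t ^ Suc n / fact (Suc n))) * ennreal (jump_power n x))"
    using assms
    by (intro suminf_cong) (simp add: ennreal_mult[symmetric] convolution_power_nonneg mult.assoc)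
  finally show ?thesis .
qed

lemma cdens_measurable [measurable]:
  assumes [measurable]: "f \<in> borel_measurable M" "h \<in> borel_measurable M"
  shows "(\<lambda>w. cdens (f w) (h w)) \<in> borel_measurable M"
  unfolding compound_density_def by measurable

lemma sums_poisson_weights: "(\<lambda>n. t ^ Suc n / fact (Suc n)) sums (exp t - 1)" for t :: real
proof -
  have "(\<lambda>n. t ^ n / fact n) sums exp t"
    using exp_converges[of t] by (simp add: divide_inverse mult.commute)
  then show ?thesis by (subst sums_Suc_iff) simp
qed

lemma nn_integral_cdens:
  assumes "0 \<le> t"
  shows "(\<integral>\<^sup>+x. ennreal (cdens x t) \<partial>lborel) = ennreal (1 - exp (- t))"
proof -
  let ?w = "\<lambda>n. exp (- t) * (t ^ Suc n / fact (Suc n))"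
  have "(\<integral>\<^sup>+x. ennreal (cdens x t) \<partial>lborel) = (\<Sum>n. \<integral>\<^sup>+x. ennreal (?w n) * ennreal (jump_power n x) \<partial>lborel)"
    unfolding ennreal_cdens[OF assms] by (rule nn_integral_suminf) measurable
  also have "\<dots> = (\<Sum>n. ennreal (?w n))"
    by (intro suminf_cong, subst nn_integral_cmult) (simp_all add: convolution_power_mass)
  also have "\<dots> = ennreal (\<Sum>n. ?w n)"
    using assms by (intro suminf_ennreal2 summable_mult sums_summable[OF sums_poisson_weights]) simp
  also have "(\<Sum>n. ?w n) = exp (- t) * (exp t - 1)"
    by (intro sums_unique[symmetric] sums_mult sums_poisson_weights)
  also have "\<dots> = 1 - exp (- t)" by (simp add: right_diff_distrib exp_minus)
  finally show ?thesis .
qed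

lemma integrable_cdens: "0 \<le> t \<Longrightarrow> integrable lborel (\<lambda>x. cdens x t)"
  by (rule nn_integral_eq_integral_finite(1)) (simp_all add: cdens_nonneg nn_integral_cdens)

lemma cdens_0: "cdens x 0 = 0"
  by (simp add: compound_density_def)

lemma cdens_nonpos: "x \<le> 0 \<Longrightarrow> cdens x t = 0"
  by (simp add: compound_density_def convolution_power_eq_0)

text \<open>For each t the mass in x is 1 - exp (- t), at most 1, so the integral over the rectangle
  is at most the length of {0..T}.\<close>

lemma set_integrable_cdens:
  "set_integrable (lborel :: (real \<times> real) measure) ({0<..R} \<times> {0..T}) (\<lambda>(x, t). cdens x t)"
proof -
  let ?F = "\<lambda>p. indicator ({0<..R} \<times> {0..T}) p *\<^sub>R (case p of (x, t) \<Rightarrow> cdens x t)"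
  have nn: "0 \<le> ?F p" for p
    by (cases p) (auto simp: indicator_def cdens_nonneg)
  have "integrable (lborel \<Otimes>\<^sub>M lborel) ?F"
  proof (rule nn_integral_eq_integral_finite(1))
    show [measurable]: "?F \<in> borel_measurable (lborel \<Otimes>\<^sub>M lborel)"
      by (simp add: case_prod_beta' borel_prod[symmetric] del: borel_prod) measurable
    have "(\<integral>\<^sup>+p. ennreal (?F p) \<partial>(lborel \<Otimes>\<^sub>M lborel)) = (\<integral>\<^sup>+t. \<integral>\<^sup>+x. ennreal (?F (x, t)) \<partial>lborel \<partial>lborel)"
      by (rule lborel_pair.nn_integral_snd[symmetric]) simp
    also have "\<dots> \<le> (\<integral>\<^sup>+t. indicator {0..T} t \<partial>lborel)"
    proof (rule nn_integral_mono)
      fix t :: real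
      show "(\<integral>\<^sup>+x. ennreal (?F (x, t)) \<partial>lborel) \<le> indicator {0..T} t"
      proof (cases "t \<in> {0..T}")
        case True
        then have "(\<integral>\<^sup>+x. ennreal (?F (x, t)) \<partial>lborel) \<le> (\<integral>\<^sup>+x. ennreal (cdens x t) \<partial>lborel)"
          by (intro nn_integral_mono) (auto simp: indicator_def)
        also have "\<dots> \<le> 1" using True nn_integral_cdens[of t] by (simp add: ennreal_le_1)
        finally show ?thesis using True by simp
      qed auto
    qed
    also have "\<dots> < \<infinity>" by (simp add: emeasure_lborel_Icc_eq)
    finally show "(\<integral>\<^sup>+p. ennreal (?F p) \<partial>(lborel \<Otimes>\<^sub>M lborel)) < \<infinity>" .
  qed (rule nn)
  then show ?thesis by (simp add: set_integrable_def lborel_prod)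
qed

text \<open>Convolving with the jump density raises each convolution power by one and leaves its
  weight alone. Finiteness at every x is what later allows the truncation of the operator to be
  removed.\<close>

lemma cdens_convolution:
  fixes x :: real
  assumes "0 \<le> t"
  defines "S \<equiv> exp (- t) * (\<Sum>n. t ^ Suc n / fact (Suc n) * jump_power (Suc n) x)"
  shows "integrable lborel (\<lambda>z. cdens z t * jump_density \<kappa> q (x - z))"
    and "(LBINT z. cdens z t * jump_density \<kappa> q (x - z)) = S"
proof -
  let ?w = "\<lambda>n. exp (- t) * (t ^ Suc n / fact (Suc n))"
  have pos: "0 \<le> cdens z t * jump_density \<kappa> q (x - z)" for z
    using assms(1) by (simp add: cdens_nonneg jump_density_nonneg)
  have sm: "summable (\<lambda>n. t ^ Suc n / fact (Suc n) * jump_power (Suc n) x)"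
    if "0 < x"
  proof -
    \<comment> \<open>The bound for \<open>jump_power (Suc n)\<close> has the exponent n + 2; the
      surplus factor is pulled out to leave the Poisson-weighted series.\<close>
    have "summable (\<lambda>n. max 1 \<kappa> * max 1 x * (2 * exp 2 / x * (t ^ Suc n / fact (Suc n) * (max 1 \<kappa> * max 1 x) ^ Suc n)))"
      by (intro summable_mult summable_poisson_weights)
    then show ?thesis
    proof (rule summable_comparison_test'[of _ 0])
      fix n :: nat
      have "t ^ Suc n / fact (Suc n) * jump_power (Suc n) x
          \<le> t ^ Suc n / fact (Suc n) * (2 * exp 2 * (max 1 \<kappa> * max 1 x) ^ Suc (Suc n) / x)"
        using assms that by (intro mult_left_mono jump_power_le) auto
      then show "norm (t ^ Suc n / fact (Suc n) * jump_power (Suc n) x)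
          \<le> max 1 \<kappa> * max 1 x * (2 * exp 2 / x * (t ^ Suc n / fact (Suc n) * (max 1 \<kappa> * max 1 x) ^ Suc n))"
        using assms convolution_power_nonneg[of "Suc n" x] by (simp add: abs_mult mult_ac)
    qed
  qed
  then have sm: "summable (\<lambda>n. t ^ Suc n / fact (Suc n) * jump_power (Suc n) x)"
    by (cases "0 < x") (auto simp: convolution_power_eq_0)
  have "(\<integral>\<^sup>+z. ennreal (cdens z t * jump_density \<kappa> q (x - z)) \<partial>lborel)
      = (\<integral>\<^sup>+z. (\<Sum>n. ennreal (?w n) * (ennreal (jump_density \<kappa> q (x - z)) * ennreal (jump_power n z))) \<partial>lborel)"
    using assms(1)
    by (intro nn_integral_cong)
      (simp add: ennreal_mult cdens_nonneg jump_density_nonneg ennreal_cdens ennreal_suminf_multc[symmetric]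
         mult_ac del: power_Suc fact_Suc)
  also have "\<dots> = (\<Sum>n. \<integral>\<^sup>+z. ennreal (?w n) * (ennreal (jump_density \<kappa> q (x - z)) * ennreal (jump_power n z)) \<partial>lborel)"
    by (rule nn_integral_suminf) measurable
  also have "\<dots> = (\<Sum>n. ennreal (?w n) * ennreal (jump_power (Suc n) x))"
    by (intro suminf_cong, subst nn_integral_cmult)
      (simp_all add: nn_integral_convolution_power_Suc)
  also have "\<dots> = (\<Sum>n. ennreal (exp (- t) * (t ^ Suc n / fact (Suc n) * jump_power (Suc n) x)))"
    using assms(1)
    by (intro suminf_cong) (simp add: ennreal_mult[symmetric] convolution_power_nonneg mult.assoc del: power_Suc fact_Suc)
  also have "\<dots> = ennreal S"
    unfolding S_def suminf_mult[OF sm, symmetric] using assms(1)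
    by (intro suminf_ennreal2 summable_mult sm) (simp add: convolution_power_nonneg)
  finally have nn: "(\<integral>\<^sup>+z. ennreal (cdens z t * jump_density \<kappa> q (x - z)) \<partial>lborel) = ennreal S" .
  have S0: "0 \<le> S"
    unfolding S_def using assms(1)
    by (intro mult_nonneg_nonneg suminf_nonneg sm) (auto simp: convolution_power_nonneg)
  have fin: "(\<integral>\<^sup>+z. ennreal (cdens z t * jump_density \<kappa> q (x - z)) \<partial>lborel) < \<infinity>" by (simp add: nn)
  have meas: "(\<lambda>z. cdens z t * jump_density \<kappa> q (x - z)) \<in> borel_measurable lborel" by measurable
  note * = nn_integral_eq_integral_finite[OF meas pos fin]
  show "integrable lborel (\<lambda>z. cdens z t * jump_density \<kappa> q (x - z))" by (rule *(1))
  have "0 \<le> (LBINT z. cdens z t * jump_density \<kappa> q (x - z))"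
    by (rule Bochner_Integration.integral_nonneg) (rule pos)
  then show "(LBINT z. cdens z t * jump_density \<kappa> q (x - z)) = S"
    using *(2) S0 unfolding nn by (simp add: ennreal_inj)
qed

text \<open>After \<open>conv_deriv_trunc_eq\<close> the limit concerns the product of the density
  with the shifted jump density, which is integrable down to 0, and not the derivative.\<close>

lemma conv_deriv_trunc_cdens:
  assumes "0 < x" "0 \<le> t"
  shows "(conv_deriv_trunc \<kappa> q (\<lambda>z. cdens z t) x \<longlongrightarrow>
      cdens x t - exp (- t) * (\<Sum>n. t ^ Suc n / fact (Suc n) * jump_power (Suc n) x)) (at_right 0)"
proof -
  let ?f = "\<lambda>z. cdens z t * jump_density \<kappa> q (x - z)"
  have "?f z = 0" if "z \<notin> {0<..x}" for z
    using that by (auto simp: cdens_nonpos jump_density_def)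
  then have ind: "indicator {0<..x} z *\<^sub>R ?f z = ?f z" for z by (cases "z \<in> {0<..x}") auto
  have "set_integrable lborel {0<..x} ?f"
    unfolding set_integrable_def ind by (rule cdens_convolution(1)[OF assms(2)])
  then have "((\<lambda>\<epsilon>. LBINT z:{\<epsilon>..x}. ?f z) \<longlongrightarrow> (LBINT z:{0<..x}. ?f z)) (at_right 0)"
    using assms(1) by (intro tendsto_set_lebesgue_integral_at_right) auto
  then have "((\<lambda>\<epsilon>. cdens x t - (LBINT z:{\<epsilon>..x}. ?f z)) \<longlongrightarrow> cdens x t - (LBINT z:{0<..x}. ?f z)) (at_right 0)"
    by (intro tendsto_diff tendsto_const)
  moreover have "(LBINT z:{0<..x}. ?f z) = exp (- t) * (\<Sum>n. t ^ Suc n / fact (Suc n) * jump_power (Suc n) x)"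
    unfolding set_lebesgue_integral_def ind by (rule cdens_convolution(2)[OF assms(2)])
  moreover have "eventually (\<lambda>\<epsilon>. cdens x t - (LBINT z:{\<epsilon>..x}. ?f z) = conv_deriv_trunc \<kappa> q (\<lambda>z. cdens z t) x \<epsilon>) (at_right 0)"
    using eventually_at_right_real[OF assms(1)]
    by eventually_elim
      (use conv_deriv_trunc_eq[OF compound_density_differentiable[OF assms(2)] compound_density_AC_loc_pos[OF assms(2)]] in simp)
  ultimately show ?thesis by (auto elim: Lim_transform_eventually)
qed

text \<open>For fixed x the density is exp (- t) times an everywhere convergent power series in t.
  Differentiating that series shifts it by one index, and its new constant term, the jump density,
  produces the forcing term.\<close>

lemma cdens_time_derivative:
  assumes x: "0 < x"
  shows "((\<lambda>t. cdens x t) has_real_derivative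
      - cdens x t + exp (- t) * (jump_density \<kappa> q x + (\<Sum>n. t ^ Suc n / fact (Suc n) * jump_power (Suc n) x))) (at t)"
proof -
  \<comment> \<open>The series starts at n = 1, so the coefficient at 0 is 0; \<open>diffs\<close>
    then turns the coefficient of index n + 1 into \<open>jump_power n x / fact n\<close>.\<close>
  let ?c = "\<lambda>n. case n of 0 \<Rightarrow> 0 | Suc m \<Rightarrow> jump_power m x / fact n"
  have sm: "summable (\<lambda>n. jump_power n x / fact (Suc n) * y ^ Suc n)" for y
  proof (rule summable_norm_cancel)
    have "summable (\<lambda>n. \<bar>y\<bar> ^ Suc n / fact (Suc n) * jump_power n x)" by (rule summable_compound) simp
    then show "summable (\<lambda>n. norm (jump_power n x / fact (Suc n) * y ^ Suc n))"
      by (simp add: abs_mult power_abs convolution_power_nonneg mult_ac del: power_Suc fact_Suc)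
  qed
  have c: "summable (\<lambda>n. ?c n * y ^ n)" for y
    using sm[of y] by (subst summable_Suc_iff[symmetric]) simp
  have D: "((\<lambda>y. \<Sum>n. ?c n * y ^ n) has_real_derivative (\<Sum>n. diffs ?c n * t ^ n)) (at t)"
    by (rule termdiffs_strong_converges_everywhere[OF c])
  have e1: "(\<Sum>n. ?c n * y ^ n) = (\<Sum>n. y ^ Suc n / fact (Suc n) * jump_power n x)" for y
    using suminf_split_head[OF c[of y]] by (simp add: mult_ac del: power_Suc fact_Suc)
  have d: "diffs ?c n * t ^ n = jump_power n x / fact n * t ^ n" for n
    by (simp add: diffs_def del: of_nat_Suc)
  have "summable (\<lambda>n. diffs ?c n * t ^ n)"
    by (rule termdiff_converges_all[OF c])
  then have "(\<Sum>n. diffs ?c n * t ^ n) = jump_power 0 x + (\<Sum>n. jump_power (Suc n) x / fact (Suc n) * t ^ Suc n)"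
    unfolding d using suminf_split_head[of "\<lambda>n. jump_power n x / fact n * t ^ n"] by (simp del: power_Suc fact_Suc)
  then have e2: "(\<Sum>n. diffs ?c n * t ^ n) = jump_density \<kappa> q x + (\<Sum>n. t ^ Suc n / fact (Suc n) * jump_power (Suc n) x)"
    by (simp add: mult_ac convolution_power_def del: power_Suc fact_Suc)
  have "((\<lambda>t. exp (- t)) has_real_derivative - exp (- t)) (at t)"
    by (auto intro!: derivative_eq_intros)
  from DERIV_mult[OF this D]
  show ?thesis
    unfolding e1 e2 compound_density_def by (simp add: mult_ac)
qed

lemma is_solution_cdens: "is_solution \<kappa> q cdens"
  unfolding is_solution_def
proof (intro conjI allI impI)
  show "set_integrable (lborel :: (real \<times> real) measure) ({0<..R} \<times> {0..T}) (\<lambda>(x, t). cdens x t)" for R T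
    by (rule set_integrable_cdens)
  show "(\<lambda>x. cdens x t) differentiable_on {0<..}" "AC_loc_pos (\<lambda>x. cdens x t)" if "0 \<le> t" for t
    using that by (rule compound_density_differentiable compound_density_AC_loc_pos)+
  show "cdens x 0 = 0" for x by (rule cdens_0)
  fix x t :: real assume x: "0 < x" and t: "0 \<le> t"
  note lim = conv_deriv_trunc_cdens[OF x t]
  then show "conv_deriv_exists \<kappa> q (\<lambda>z. cdens z t) x"
    by (auto simp: conv_deriv_exists_def)
  have cd: "conv_deriv \<kappa> q (\<lambda>z. cdens z t) x
      = cdens x t - exp (- t) * (\<Sum>n. t ^ Suc n / fact (Suc n) * jump_power (Suc n) x)"
    unfolding conv_deriv_def by (intro tendsto_Lim lim) simp
  have e: "exp (- t - \<kappa> * x) * (LBINT \<rho>:{0<..<1}. \<kappa> powr \<rho> * x powr (\<rho> - 1) / Gamma \<rho> * q \<rho>)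
      = exp (- t) * jump_density \<kappa> q x"
    using x by (simp add: jump_density_def exp_diff exp_minus field_simps)
  have "- conv_deriv \<kappa> q (\<lambda>z. cdens z t) x + exp (- t) * jump_density \<kappa> q x
      = - cdens x t + exp (- t) * (jump_density \<kappa> q x + (\<Sum>n. t ^ Suc n / fact (Suc n) * jump_power (Suc n) x))"
    unfolding cd by (simp add: distrib_left)
  then show "((\<lambda>s. cdens x s) has_real_derivative
      - conv_deriv \<kappa> q (\<lambda>z. cdens z t) x
      + exp (- t - \<kappa> * x) * (LBINT \<rho>:{0<..<1}. \<kappa> powr \<rho> * x powr (\<rho> - 1) / Gamma \<rho> * q \<rho>)) (at t within {0..})"
    unfolding e using cdens_time_derivative[OF x, of t]
    by (simp add: has_field_derivative_at_within)
qed

end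

subsection \<open>The law of the compound Poisson process\<close>

lemma poisson_process_prob:
  assumes "prob_space M" "poisson_process M 1 N" "0 \<le> t"
  shows "measure M {\<omega> \<in> space M. N t \<omega> = n} = exp (- t) * (t ^ n / fact n)"
proof -
  interpret prob_space M by fact
  have meas: "N s \<in> measurable M (count_space UNIV)" if "0 \<le> s" for s
    using assms(2) that unfolding poisson_process_def by blast
  note [measurable] = meas[OF assms(3)] meas[OF order_refl]
  have N0: "AE \<omega> in M. N 0 \<omega> = 0"
    using assms(2) unfolding poisson_process_def by blast
  show ?thesis
  \<comment> \<open>The law of an increment is prescribed only for s < t, so time 0 is treated
    through N 0 = 0 almost surely.\<close>
  proof (cases "t = 0")
    case True
    have "measure M {\<omega> \<in> space M. N 0 \<omega> = n} = measure M (if n = 0 then space M else {})"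
      by (rule measure_eq_AE) (use N0 in auto)
    then show ?thesis using True by (simp add: prob_space)
  next
    case False
    then have t: "0 < t" using assms(3) by simp
    then have d: "distr M (count_space UNIV) (\<lambda>\<omega>. N t \<omega> - N 0 \<omega>) = measure_pmf (poisson_pmf (1 * (t - 0)))"
      using assms(2) unfolding poisson_process_def by blast
    have "measure M {\<omega> \<in> space M. N t \<omega> = n} = measure M {\<omega> \<in> space M. N t \<omega> - N 0 \<omega> = n}"
      by (rule measure_eq_AE) (use N0 in auto)
    also have "\<dots> = measure (distr M (count_space UNIV) (\<lambda>\<omega>. N t \<omega> - N 0 \<omega>)) {n}"
      by (subst measure_distr) (auto intro!: arg_cong[where f = "measure M"])
    also have "\<dots> = pmf (poisson_pmf t) n"
      unfolding d by (simp add: pmf.rep_eq)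
    also have "\<dots> = exp (- t) * (t ^ n / fact n)"
      using t by (simp add: mult.commute)
    finally show ?thesis .
  qed
qed

context shape_mixture
begin

text \<open>The recursion for \<open>convolution_power\<close> has the shape of the convolution
  formula for sums of independent variables, so the induction yields exactly the version of the
  density used in the series.\<close>

lemma distributed_jump_sum:
  assumes "prob_space M" "prob_space.indep_vars M (\<lambda>_. borel) X {1..}"
    and d: "\<And>j::nat. 1 \<le> j \<Longrightarrow> distributed M lborel (X j) (\<lambda>x. ennreal (jump_density \<kappa> q x))"
  shows "distributed M lborel (\<lambda>\<omega>. \<Sum>j=1..Suc n. X j \<omega>) (\<lambda>x. ennreal (jump_power n x))"
proof (induction n)
  case 0
  show ?case using d[of 1] by (simp add: convolution_power_def)
next
  case (Suc n)
  interpret prob_space M by fact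
  let ?i = "Suc (Suc n)"
  have "indep_vars (\<lambda>_. borel) X (insert ?i {1..Suc n})"
    using assms(2) by (rule indep_vars_subset) auto
  then have "indep_var borel (X ?i) borel (\<lambda>\<omega>. \<Sum>j=1..Suc n. X j \<omega>)"
    by (intro indep_vars_sum) auto
  from distributed_convolution[OF this d Suc]
  have "distributed M lborel (\<lambda>\<omega>. X ?i \<omega> + (\<Sum>j=1..Suc n. X j \<omega>)) (\<lambda>x. ennreal (jump_power (Suc n) x))"
    by (simp add: nn_integral_convolution_power_Suc)
  then show ?case by (simp add: add.commute)
qed

text \<open>Conditioning on the number of jumps: N t = n is an event of the counting process and a
  bound on the n-th partial sum is an event of the jumps, so the probabilities multiply. The case n
  = 0 is the atom; the others add up to the series.\<close>

lemma ac_component_density_cdens: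
  assumes M: "prob_space M" and N: "poisson_process M 1 N"
    and X: "prob_space.indep_vars M (\<lambda>_. borel) X {1..}"
    and d: "\<And>j. 1 \<le> j \<Longrightarrow> distributed M lborel (X j) (\<lambda>x. ennreal (jump_density \<kappa> q x))"
    and indep: "prob_space.indep_set M
           (sets (vimage_algebra (space M) (\<lambda>\<omega>. \<lambda>t\<in>{0..}. N t \<omega>)
              (PiM {0..} (\<lambda>_. count_space UNIV))))
           (sets (vimage_algebra (space M) (\<lambda>\<omega>. \<lambda>j\<in>{1..}. X j \<omega>)
              (PiM {1..} (\<lambda>_. borel))))"
  shows "ac_component_density M (compound_sum N X) cdens"
  unfolding ac_component_density_def
proof (intro allI impI conjI)
  fix t :: real assume t: "0 \<le> t"
  show "0 \<le> cdens x t" for x by (rule cdens_nonneg[OF t])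
  show "integrable lborel (\<lambda>x. cdens x t)" by (rule integrable_cdens[OF t])
  fix y :: real
  interpret prob_space M by fact
  define A where "A = (\<lambda>n. {\<omega> \<in> space M. N t \<omega> = n})"
  define B where "B = (\<lambda>n. {\<omega> \<in> space M. (\<Sum>j=1..n. X j \<omega>) \<le> y})"
  have [measurable]: "N t \<in> measurable M (count_space UNIV)"
    using N t unfolding poisson_process_def by blast
  have X_meas: "X j \<in> borel_measurable M" if "1 \<le> j" for j
    using distributed_measurable[OF d[OF that]] by simp
  then have [measurable]: "(\<lambda>\<omega>. \<Sum>j=1..n. X j \<omega>) \<in> borel_measurable M" for n
    by (intro borel_measurable_sum) auto
  have AB: "A n \<in> sets M" "B n \<in> sets M" for n
    unfolding A_def B_def by measurable
  have A: "A n \<in> sets (vimage_algebra (space M) (\<lambda>\<omega>. \<lambda>t\<in>{0..}. N t \<omega>) (PiM {0..} (\<lambda>_. count_space UNIV)))" for n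
  proof -
    let ?P = "PiM {0::real..} (\<lambda>_. count_space (UNIV :: nat set))"
    have [measurable]: "(\<lambda>f. f t) \<in> measurable ?P (count_space UNIV)"
      using t by (intro measurable_component_singleton) simp
    have "{f \<in> space ?P. f t = n} \<in> sets ?P" by measurable
    from in_vimage_algebra[OF this, of "\<lambda>\<omega>. \<lambda>t\<in>{0..}. N t \<omega>" "space M"]
    show ?thesis
      by (rule back_subst[where P = "\<lambda>S. S \<in> _"]) (use t in \<open>auto simp: A_def space_PiM\<close>)
  qed
  have B: "B n \<in> sets (vimage_algebra (space M) (\<lambda>\<omega>. \<lambda>j\<in>{1..}. X j \<omega>) (PiM {1..} (\<lambda>_. borel)))" for n
  proof -
    let ?P = "PiM {1::nat..} (\<lambda>_. borel :: real measure)"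
    have [measurable]: "(\<lambda>f. \<Sum>j=1..n. f j) \<in> borel_measurable ?P"
      by (intro borel_measurable_sum measurable_component_singleton) simp
    have "{f \<in> space ?P. (\<Sum>j=1..n. f j) \<le> y} \<in> sets ?P" by measurable
    from in_vimage_algebra[OF this, of "\<lambda>\<omega>. \<lambda>j\<in>{1..}. X j \<omega>" "space M"]
    show ?thesis
      by (rule back_subst[where P = "\<lambda>S. S \<in> _"]) (auto simp: B_def space_PiM)
  qed
  have pAB: "measure M (A n \<inter> B n) = exp (- t) * (t ^ n / fact n) * measure M (B n)" for n
    using indep_setD[OF indep A B] poisson_process_prob[OF M N t] by (simp add: A_def)
  have un: "(\<Union>n. A n \<inter> B n) = {\<omega> \<in> space M. compound_sum N X t \<omega> \<le> y}"
    by (auto simp: A_def B_def compound_sum_def)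
  have "(\<lambda>n. measure M (A n \<inter> B n)) sums measure M (\<Union>n. A n \<inter> B n)"
    using AB by (intro finite_measure_UNION) (auto simp: disjoint_family_on_def A_def)
  then have sums: "(\<lambda>n. measure M (A (Suc n) \<inter> B (Suc n))) sums
      (measure M {\<omega> \<in> space M. compound_sum N X t \<omega> \<le> y} - measure M (A 0 \<inter> B 0))"
    unfolding un by (subst sums_Suc_iff) simp
  \<comment> \<open>The empty sum is 0, so this event is everything or nothing according to the sign
    of y.\<close>
  have "B 0 = (if 0 \<le> y then space M else {})" by (simp add: B_def)
  then have p0: "measure M (A 0 \<inter> B 0) = exp (- t) * indicator {0..} y"
    unfolding pAB by (simp add: prob_space)
  have pS: "ennreal (measure M (A (Suc n) \<inter> B (Suc n)))
      = (\<integral>\<^sup>+x. ennreal (exp (- t) * (t ^ Suc n / fact (Suc n))) * ennreal (jump_power n x) * indicator {..y} x \<partial>lborel)" for n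
  proof -
    have "B (Suc n) = (\<lambda>\<omega>. \<Sum>j=1..Suc n. X j \<omega>) -` {..y} \<inter> space M" by (auto simp: B_def)
    then have b: "ennreal (measure M (B (Suc n))) = (\<integral>\<^sup>+x. ennreal (jump_power n x) * indicator {..y} x \<partial>lborel)"
      using distributed_emeasure[OF distributed_jump_sum[OF M X d], of "{..y}" n]
      by (simp add: emeasure_eq_measure)
    have c: "0 \<le> exp (- t) * (t ^ Suc n / fact (Suc n))" using t by simp
    have "ennreal (measure M (A (Suc n) \<inter> B (Suc n))) = ennreal (exp (- t) * (t ^ Suc n / fact (Suc n)))
        * (\<integral>\<^sup>+x. ennreal (jump_power n x) * indicator {..y} x \<partial>lborel)"
      unfolding pAB ennreal_mult'[OF c] b ..
    also have "\<dots> = (\<integral>\<^sup>+x. ennreal (exp (- t) * (t ^ Suc n / fact (Suc n))) * (ennreal (jump_power n x) * indicator {..y} x) \<partial>lborel)"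
      by (rule nn_integral_cmult[symmetric]) measurable
    finally show ?thesis by (simp only: mult.assoc)
  qed
  let ?f = "\<lambda>x. indicator {..y} x *\<^sub>R cdens x t"
  have int: "integrable lborel ?f"
    using integrable_cdens[OF t] by (intro integrable_mult_indicator) auto
  have "ennreal (LBINT x:{..y}. cdens x t) = (\<integral>\<^sup>+x. ennreal (?f x) \<partial>lborel)"
    unfolding set_lebesgue_integral_def using int
    by (intro nn_integral_eq_integral[symmetric]) (auto simp: cdens_nonneg t)
  also have "\<dots> = (\<integral>\<^sup>+x. (\<Sum>n. ennreal (exp (- t) * (t ^ Suc n / fact (Suc n))) * ennreal (jump_power n x) * indicator {..y} x) \<partial>lborel)"
    by (intro nn_integral_cong) (auto simp: indicator_def ennreal_cdens[OF t] simp del: power_Suc fact_Suc)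
  also have "\<dots> = (\<Sum>n. ennreal (measure M (A (Suc n) \<inter> B (Suc n))))"
    unfolding pS by (rule nn_integral_suminf) measurable
  also have "\<dots> = ennreal (\<Sum>n. measure M (A (Suc n) \<inter> B (Suc n)))"
    by (intro suminf_ennreal2 sums_summable[OF sums]) simp
  finally have "(LBINT x:{..y}. cdens x t) = (\<Sum>n. measure M (A (Suc n) \<inter> B (Suc n)))"
    by (subst (asm) ennreal_inj)
      (auto simp: set_lebesgue_integral_def cdens_nonneg t intro!: Bochner_Integration.integral_nonneg suminf_nonneg sums_summable[OF sums])
  then have "(LBINT x:{..y}. cdens x t)
      = measure M {\<omega> \<in> space M. compound_sum N X t \<omega> \<le> y} - exp (- t) * indicator {0..} y"
    using sums_unique[OF sums] p0 by simp
  then show "measure M {\<omega> \<in> space M. compound_sum N X t \<omega> \<le> y}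
      = exp (- t) * indicator {0..} y + (LBINT x:{..y}. cdens x t)"
    by simp
qed

end

subsection \<open>Uniqueness\<close>

text \<open>The rate 2 makes the tail equal to half the weight at s; this is the contraction factor
  in the uniqueness argument.\<close>

lemma nn_integral_exp_tail:
  "(\<integral>\<^sup>+t. ennreal (exp (- 2 * t)) * indicator {s..} t \<partial>lborel) = ennreal (exp (- 2 * s) / 2)" for s :: real
proof -
  have "(\<integral>\<^sup>+t. ennreal (exp (- 2 * t)) * indicator {s..} t \<partial>lborel) = 0 - (- (exp (- 2 * s) / 2))"
  proof (rule nn_integral_FTC_atLeast)
    show "((\<lambda>t::real. - (exp (- 2 * t) / 2)) has_real_derivative exp (- 2 * t)) (at t)" for t
      by (auto intro!: derivative_eq_intros)
    show "((\<lambda>t::real. - (exp (- 2 * t) / 2)) \<longlongrightarrow> 0) at_top"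
      by real_asymp
  qed auto
  then show ?thesis by simp
qed

text \<open>Integrating the hypothesis against the weight \<open>exp (- 2 * t)\<close> bounds a finite quantity by
  half of itself.\<close>

lemma integral_gronwall_zero:
  fixes m :: "real \<Rightarrow> ennreal"
  assumes m [measurable]: "m \<in> borel_measurable borel"
    and fin: "(\<integral>\<^sup>+t. m t \<partial>lborel) < \<infinity>"
    and le: "\<And>t. 0 \<le> t \<Longrightarrow> m t \<le> (\<integral>\<^sup>+s. m s * indicator {0..t} s \<partial>lborel)"
    and t: "0 \<le> t"
  shows "m t = 0"
proof -
  let ?e = "\<lambda>t::real. ennreal (exp (- 2 * t))"
  define V where "V = (\<integral>\<^sup>+t. ?e t * indicator {0..} t * m t \<partial>lborel)"
  have "V \<le> (\<integral>\<^sup>+t. m t \<partial>lborel)"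
    unfolding V_def
  proof (rule nn_integral_mono)
    fix t :: real
    have "?e t * indicator {0..} t \<le> 1"
      by (auto simp: indicator_def intro!: ennreal_le_1[THEN iffD2])
    then have "?e t * indicator {0..} t * m t \<le> 1 * m t" by (rule mult_right_mono) simp
    then show "?e t * indicator {0..} t * m t \<le> m t" by simp
  qed
  then have Vfin: "V < \<infinity>" using fin by (rule le_less_trans)
  have "V \<le> (\<integral>\<^sup>+t. \<integral>\<^sup>+s. ?e t * indicator {0..} t * (m s * indicator {0..t} s) \<partial>lborel \<partial>lborel)"
    unfolding V_def
  proof (rule nn_integral_mono)
    fix t :: real
    have "?e t * indicator {0..} t * m t \<le> ?e t * indicator {0..} t * (\<integral>\<^sup>+s. m s * indicator {0..t} s \<partial>lborel)"
      using le[of t] by (cases "0 \<le> t") (auto intro!: mult_left_mono)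
    also have "\<dots> = (\<integral>\<^sup>+s. ?e t * indicator {0..} t * (m s * indicator {0..t} s) \<partial>lborel)"
      by (rule nn_integral_cmult[symmetric]) measurable
    finally show "?e t * indicator {0..} t * m t \<le> \<dots>" .
  qed
  \<comment> \<open>The region 0 \<le> s \<le> t is described from s, so that after the exchange the
    inner integral is an exponential tail.\<close>
  also have "\<dots> = (\<integral>\<^sup>+t. \<integral>\<^sup>+s. m s * indicator {0..} s * (?e t * indicator {s..} t) \<partial>lborel \<partial>lborel)"
    by (intro nn_integral_cong) (auto simp: indicator_def mult_ac)
  also have "\<dots> = (\<integral>\<^sup>+s. \<integral>\<^sup>+t. m s * indicator {0..} s * (?e t * indicator {s..} t) \<partial>lborel \<partial>lborel)"
  proof (rule lborel_pair.Fubini')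
    have "(\<lambda>p. m (fst p) * indicator {0..} (fst p) * (?e (snd p) * (if fst p \<le> snd p then 1 else 0)))
        \<in> borel_measurable (lborel \<Otimes>\<^sub>M lborel)"
      by measurable
    then show "case_prod (\<lambda>s t. m s * indicator {0..} s * (?e t * indicator {s..} t)) \<in> borel_measurable (lborel \<Otimes>\<^sub>M lborel)"
      by (simp add: case_prod_beta' indicator_def of_bool_def)
  qed
  also have "\<dots> = (\<integral>\<^sup>+s. m s * indicator {0..} s * ennreal (exp (- 2 * s) / 2) \<partial>lborel)"
  proof (intro nn_integral_cong)
    fix s
    have "(\<integral>\<^sup>+t. m s * indicator {0..} s * (?e t * indicator {s..} t) \<partial>lborel)
        = m s * indicator {0..} s * (\<integral>\<^sup>+t. ?e t * indicator {s..} t \<partial>lborel)"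
      by (rule nn_integral_cmult) measurable
    then show "(\<integral>\<^sup>+t. m s * indicator {0..} s * (?e t * indicator {s..} t) \<partial>lborel)
        = m s * indicator {0..} s * ennreal (exp (- 2 * s) / 2)"
      unfolding nn_integral_exp_tail .
  qed
  also have "\<dots> = (\<integral>\<^sup>+s. ennreal (1/2) * (?e s * indicator {0..} s * m s) \<partial>lborel)"
  proof (intro nn_integral_cong)
    fix s
    have "ennreal (exp (- 2 * s) / 2) = ennreal (1/2) * ?e s"
      by (subst ennreal_mult[symmetric]) auto
    then show "m s * indicator {0..} s * ennreal (exp (- 2 * s) / 2) = ennreal (1/2) * (?e s * indicator {0..} s * m s)"
      by (simp add: mult_ac)
  qed
  also have "\<dots> = ennreal (1/2) * V"
    unfolding V_def by (rule nn_integral_cmult) measurable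
  finally have "V \<le> ennreal (1/2) * V" .
  moreover obtain r where r: "V = ennreal r" "0 \<le> r" using Vfin by (cases V) auto
  moreover have "ennreal (1/2) * ennreal r = ennreal (1/2 * r)"
    by (rule ennreal_mult[symmetric]) (use r in auto)
  ultimately have "ennreal r \<le> ennreal (1/2 * r)" by (simp only:)
  then have "r \<le> 1/2 * r" using r(2) by (subst (asm) ennreal_le_iff) auto
  then have "V = 0" using r by simp
  then have ae: "AE t in lborel. ?e t * indicator {0..} t * m t = 0"
    unfolding V_def by (subst (asm) nn_integral_0_iff_AE) auto
  \<comment> \<open>V = 0 gives m = 0 only almost everywhere on the half-line; the hypothesis
    \<open>le\<close> turns this into a statement at every t.\<close>
  have "m t \<le> (\<integral>\<^sup>+s. m s * indicator {0..t} s \<partial>lborel)" by (rule le[OF t])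
  also have "\<dots> = (\<integral>\<^sup>+s. 0 \<partial>(lborel :: real measure))"
    using ae by (intro nn_integral_cong_AE, eventually_elim) (auto simp: indicator_def split: if_splits)
  finally show ?thesis by simp
qed

text \<open>Lebesgue integrability of D is not assumed: F t is its Henstock-Kurzweil integral by the
  fundamental theorem, compared with an integrable majorant. If the right-hand side is infinite the
  claim is trivial; otherwise \<phi> is finite almost everywhere on {0..t}.\<close>

lemma abs_le_nn_integral_deriv_bound:
  fixes F D :: "real \<Rightarrow> real" and \<phi> :: "real \<Rightarrow> ennreal"
  assumes t: "0 \<le> t" and F0: "F 0 = 0"
    and der: "\<And>s. s \<in> {0..t} \<Longrightarrow> (F has_real_derivative D s) (at s within {0..t})"
    and bound: "\<And>s. s \<in> {0..t} \<Longrightarrow> ennreal \<bar>D s\<bar> \<le> \<phi> s"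
    and [measurable]: "\<phi> \<in> borel_measurable borel"
  shows "ennreal \<bar>F t\<bar> \<le> (\<integral>\<^sup>+s. \<phi> s * indicator {0..t} s \<partial>lborel)"
proof (cases "(\<integral>\<^sup>+s. \<phi> s * indicator {0..t} s \<partial>lborel) = \<infinity>")
  case False
  define \<psi> where "\<psi> = (\<lambda>s. enn2real (\<phi> s * indicator {0..t} s))"
  define Z where "Z = {s. \<phi> s * indicator {0..t} s = \<infinity>}"
  have [measurable]: "\<psi> \<in> borel_measurable borel" unfolding \<psi>_def by measurable
  have fin: "AE s in lborel. \<phi> s * indicator {0..t} s \<noteq> \<infinity>"
    using False by (intro nn_integral_PInf_AE) auto
  have \<psi>: "(\<integral>\<^sup>+s. ennreal (\<psi> s) \<partial>lborel) = (\<integral>\<^sup>+s. \<phi> s * indicator {0..t} s \<partial>lborel)"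
    using fin by (intro nn_integral_cong_AE, eventually_elim) (simp add: \<psi>_def less_top)
  have \<psi>0: "0 \<le> \<psi> s" for s by (simp add: \<psi>_def)
  have \<psi>_meas: "\<psi> \<in> borel_measurable lborel" by measurable
  have \<psi>_fin: "(\<integral>\<^sup>+s. ennreal (\<psi> s) \<partial>lborel) < \<infinity>" using False unfolding \<psi> by (simp add: less_top)
  note \<psi>_int = nn_integral_eq_integral_finite[OF \<psi>_meas \<psi>0 \<psi>_fin]
  have ind: "indicator {0..t} s *\<^sub>R \<psi> s = \<psi> s" for s by (auto simp: \<psi>_def indicator_def)
  have \<psi>_set: "set_integrable lborel {0..t} \<psi>"
    unfolding set_integrable_def ind by (rule \<psi>_int(1))
  have "Z \<in> null_sets lborel"
    using fin unfolding Z_def by (subst (asm) AE_iff_null) auto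
  then have Z: "negligible Z"
    by (simp add: negligible_iff_null_sets null_sets_completionI)
  have "(D has_integral (F t - F 0)) {0..t}"
    using t der by (intro fundamental_theorem_of_calculus)
      (auto simp: has_real_derivative_iff_has_vector_derivative)
  then have "(D has_integral F t) {0..t}" using F0 by simp
  \<comment> \<open>On the null set where \<phi> is infinite the real majorant \<psi> is 0 and
    dominates nothing; setting D to 0 there does not change its integral.\<close>
  then have D': "((\<lambda>s. if s \<in> Z then 0 else D s) has_integral F t) {0..t}"
    by (rule has_integral_spike[OF Z, rotated]) auto
  have "norm (integral {0..t} (\<lambda>s. if s \<in> Z then 0 else D s)) \<le> integral {0..t} \<psi>"
  proof (rule integral_norm_bound_integral)
    show "(\<lambda>s. if s \<in> Z then 0 else D s) integrable_on {0..t}" using D' by (rule has_integral_integrable)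
    show "\<psi> integrable_on {0..t}" by (rule set_borel_integral_eq_integral(1)[OF \<psi>_set])
    fix s assume s: "s \<in> {0..t}"
    show "norm (if s \<in> Z then 0 else D s) \<le> \<psi> s"
    proof (cases "s \<in> Z")
      case False
      then have "ennreal (\<psi> s) = \<phi> s" using s by (simp add: \<psi>_def Z_def less_top)
      then have "ennreal \<bar>D s\<bar> \<le> ennreal (\<psi> s)" using bound[OF s] by simp
      then show ?thesis using False \<psi>0 by (simp add: ennreal_le_iff)
    qed (simp add: \<psi>0)
  qed
  then have "\<bar>F t\<bar> \<le> integral {0..t} \<psi>" using integral_unique[OF D'] by simp
  also have "integral {0..t} \<psi> = (\<integral>s. \<psi> s \<partial>lborel)"
    using set_borel_integral_eq_integral(2)[OF \<psi>_set] unfolding set_lebesgue_integral_def ind by simp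
  finally have "ennreal \<bar>F t\<bar> \<le> ennreal (\<integral>s. \<psi> s \<partial>lborel)" by (rule ennreal_leI)
  then show ?thesis unfolding \<psi>_int(2) \<psi> .
qed simp

lemma is_solutionD:
  assumes "is_solution \<kappa> q f"
  shows "0 \<le> t \<Longrightarrow> (\<lambda>x. f x t) differentiable_on {0<..}"
    and "0 \<le> t \<Longrightarrow> AC_loc_pos (\<lambda>x. f x t)"
    and "0 \<le> x \<Longrightarrow> f x 0 = 0"
    and "0 < x \<Longrightarrow> 0 \<le> t \<Longrightarrow> conv_deriv_exists \<kappa> q (\<lambda>z. f z t) x"
    and "0 < x \<Longrightarrow> 0 \<le> t \<Longrightarrow> ((\<lambda>s. f x s) has_real_derivative
           (- conv_deriv \<kappa> q (\<lambda>z. f z t) x + exp (- t - \<kappa> * x) *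
              (LBINT \<rho>:{0<..<1}. \<kappa> powr \<rho> * x powr (\<rho> - 1) / Gamma \<rho> * q \<rho>))) (at t within {0..})"
  using assms by (simp_all add: is_solution_def)

section \<open>Comparison of two solutions\<close>

context shape_mixture
begin

text \<open>Existence of the operator is thus convergence of an improper convolution integral at 0,
  which need not converge absolutely.\<close>

lemma conv_deriv_limit:
  assumes "f differentiable_on {0<..}" "AC_loc_pos f" "conv_deriv_exists \<kappa> q f x" "0 < x"
  shows "((\<lambda>\<epsilon>. LBINT z:{\<epsilon>..x}. f z * jump_density \<kappa> q (x - z)) \<longlongrightarrow> f x - conv_deriv \<kappa> q f x) (at_right 0)"
proof -
  obtain d where d: "(conv_deriv_trunc \<kappa> q f x \<longlongrightarrow> d) (at_right 0)"
    using assms(3) unfolding conv_deriv_exists_def by blast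
  have "conv_deriv \<kappa> q f x = d"
    unfolding conv_deriv_def by (rule tendsto_Lim[OF _ d]) simp
  then have "((\<lambda>\<epsilon>. f x - conv_deriv_trunc \<kappa> q f x \<epsilon>) \<longlongrightarrow> f x - conv_deriv \<kappa> q f x) (at_right 0)"
    using d by (intro tendsto_diff tendsto_const) simp
  moreover have "eventually (\<lambda>\<epsilon>. f x - conv_deriv_trunc \<kappa> q f x \<epsilon> = (LBINT z:{\<epsilon>..x}. f z * jump_density \<kappa> q (x - z))) (at_right 0)"
    using eventually_at_right_real[OF assms(4)]
    by eventually_elim (use conv_deriv_trunc_eq[OF assms(1,2)] in simp)
  ultimately show ?thesis by (rule Lim_transform_eventually)
qed

text \<open>Each truncated integral of the difference is bounded by the full nonnegative integral,
  uniformly in \<epsilon>, and the bound passes to the limit. An infinite right-hand side is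
  allowed.\<close>

lemma conv_deriv_diff_le:
  assumes f: "f differentiable_on {0<..}" "AC_loc_pos f" "conv_deriv_exists \<kappa> q f x"
    and g: "g differentiable_on {0<..}" "AC_loc_pos g" "conv_deriv_exists \<kappa> q g x"
    and x: "0 < x"
  shows "ennreal \<bar>(f x - conv_deriv \<kappa> q f x) - (g x - conv_deriv \<kappa> q g x)\<bar>
    \<le> (\<integral>\<^sup>+z. ennreal \<bar>indicator {0<..x} z * (f z - g z)\<bar> * ennreal (jump_density \<kappa> q (x - z)) \<partial>lborel)"
    (is "ennreal \<bar>?L\<bar> \<le> ?I")
proof (cases "?I = \<infinity>")
  case False
  then obtain c where c: "?I = ennreal c" "0 \<le> c" by (cases ?I) auto
  let ?j = "\<lambda>z. jump_density \<kappa> q (x - z)"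
  have lim: "((\<lambda>\<epsilon>. (LBINT z:{\<epsilon>..x}. f z * ?j z) - (LBINT z:{\<epsilon>..x}. g z * ?j z)) \<longlongrightarrow> ?L) (at_right 0)"
    by (intro tendsto_diff conv_deriv_limit f g x)
  have "eventually (\<lambda>\<epsilon>. \<bar>(LBINT z:{\<epsilon>..x}. f z * ?j z) - (LBINT z:{\<epsilon>..x}. g z * ?j z)\<bar> \<le> c) (at_right 0)"
    using eventually_at_right_real[OF x]
  proof eventually_elim
    fix \<epsilon> assume e: "\<epsilon> \<in> {0<..<x}"
    have "continuous_on {\<epsilon>..x} f" "continuous_on {\<epsilon>..x} g"
      using differentiable_imp_continuous_on[OF f(1)] differentiable_imp_continuous_on[OF g(1)] e
      by (auto intro: continuous_on_subset)
    note int = this[THEN set_integrable_mult_jump_density]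
    have int': "set_integrable lborel {\<epsilon>..x} (\<lambda>z. f z * ?j z - g z * ?j z)"
      by (rule set_integral_diff(1)[OF int])
    have "ennreal \<bar>(LBINT z:{\<epsilon>..x}. f z * ?j z) - (LBINT z:{\<epsilon>..x}. g z * ?j z)\<bar>
        = ennreal (norm (LBINT z:{\<epsilon>..x}. f z * ?j z - g z * ?j z))"
      by (simp add: set_integral_diff(2)[OF int])
    also have "\<dots> \<le> (\<integral>\<^sup>+z. ennreal (norm (indicator {\<epsilon>..x} z *\<^sub>R (f z * ?j z - g z * ?j z))) \<partial>lborel)"
      unfolding set_lebesgue_integral_def
      using int' by (intro integral_norm_bound_ennreal) (simp add: set_integrable_def)
    also have "\<dots> \<le> ?I"
      using e by (intro nn_integral_mono)
        (auto simp: indicator_def left_diff_distrib[symmetric] abs_mult jump_density_nonneg ennreal_mult[symmetric])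
    finally show "\<bar>(LBINT z:{\<epsilon>..x}. f z * ?j z) - (LBINT z:{\<epsilon>..x}. g z * ?j z)\<bar> \<le> c"
      unfolding c(1) using c(2) by (simp add: ennreal_le_iff)
  qed
  then have "\<bar>?L\<bar> \<le> c"
    by (rule tendsto_upperbound[OF tendsto_rabs[OF lim]]) simp
  then show ?thesis unfolding c(1) by (rule ennreal_leI)
qed simp

text \<open>The operator at x sees only (0, x], so the estimate closes on the rectangle (0, R] times
  [0, T], where local integrability makes the L1 norm in both variables finite.\<close>

lemma solution_unique:
  assumes f: "is_solution \<kappa> q f" and g: "is_solution \<kappa> q g" and x0: "0 < x0" and t0: "0 \<le> t0"
  shows "f x0 t0 = g x0 t0"
proof -
  define R where "R = x0"
  \<comment> \<open>Local integrability is stated for positive T, while t0 may be 0.\<close>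
  define T where "T = t0 + 1"
  have R: "0 < R" and T: "0 < T" using x0 t0 by (auto simp: R_def T_def)
  \<comment> \<open>The factor exp t cancels the term - f in the equation and the forcing terms drop
    out, leaving the convolution of u with the jump density as time derivative.\<close>
  define u where "u = (\<lambda>x t. exp t * (f x t - g x t))"
  define v where "v = (\<lambda>p. indicator ({0<..R} \<times> {0..T}) p * u (fst p) (snd p))"
  define \<Phi> where "\<Phi> = (\<lambda>x s. \<integral>\<^sup>+z. ennreal \<bar>v (z, s)\<bar> * ennreal (jump_density \<kappa> q (x - z)) \<partial>lborel)"
  define m where "m = (\<lambda>s. \<integral>\<^sup>+z. ennreal \<bar>v (z, s)\<bar> \<partial>lborel)"
  let ?I = "\<lambda>h p. indicator ({0<..R} \<times> {0..T}) p *\<^sub>R (case p of (x, t) \<Rightarrow> (h x t :: real))"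
  have "set_integrable (lborel :: (real \<times> real) measure) ({0<..R} \<times> {0..T}) (\<lambda>(x, t). f x t)"
    "set_integrable (lborel :: (real \<times> real) measure) ({0<..R} \<times> {0..T}) (\<lambda>(x, t). g x t)"
    using f[unfolded is_solution_def, THEN conjunct1, rule_format, OF R T]
      g[unfolded is_solution_def, THEN conjunct1, rule_format, OF R T] .
  then have intI: "integrable (lborel \<Otimes>\<^sub>M lborel) (?I f)" "integrable (lborel \<Otimes>\<^sub>M lborel) (?I g)"
    by (simp_all add: set_integrable_def lborel_prod)
  have vI: "v p = exp (snd p) * (?I f p - ?I g p)" for p
    by (cases p) (simp add: v_def u_def right_diff_distrib left_diff_distrib mult_ac)
  have v_meas [measurable]: "v \<in> borel_measurable (borel \<Otimes>\<^sub>M borel)"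
  proof -
    have "?I f \<in> borel_measurable (borel \<Otimes>\<^sub>M borel)" "?I g \<in> borel_measurable (borel \<Otimes>\<^sub>M borel)"
      using borel_measurable_integrable[OF intI(1)] borel_measurable_integrable[OF intI(2)]
      by (simp_all cong: measurable_cong_sets)
    then show ?thesis unfolding vI[abs_def] by measurable
  qed
  have v_fin: "(\<integral>\<^sup>+p. ennreal \<bar>v p\<bar> \<partial>(lborel \<Otimes>\<^sub>M lborel)) < \<infinity>"
  proof -
    have "integrable (lborel \<Otimes>\<^sub>M lborel) (\<lambda>p. exp T * (?I f p - ?I g p))"
      by (intro integrable_mult_right Bochner_Integration.integrable_diff intI)
    then have "integrable (lborel \<Otimes>\<^sub>M lborel) v"
    proof (rule Bochner_Integration.integrable_bound)
      show "AE p in lborel \<Otimes>\<^sub>M lborel. norm (v p) \<le> norm (exp T * (?I f p - ?I g p))"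
        by (intro AE_I2) (auto simp: vI abs_mult indicator_def intro!: mult_right_mono)
    qed simp
    then show ?thesis by (simp add: integrable_iff_bounded)
  qed
  have m_meas [measurable]: "m \<in> borel_measurable borel"
    unfolding m_def by measurable
  have m_fin: "(\<integral>\<^sup>+s. m s \<partial>lborel) < \<infinity>"
    using v_fin unfolding m_def by (subst lborel_pair.nn_integral_snd) auto
  have \<Phi>_meas [measurable]: "(\<lambda>p. \<Phi> (snd p) (fst p)) \<in> borel_measurable (borel \<Otimes>\<^sub>M borel)"
    unfolding \<Phi>_def by measurable
  have \<Phi>_meas' [measurable]: "\<Phi> x \<in> borel_measurable borel" for x
    unfolding \<Phi>_def by measurable
  have mass: "(\<integral>\<^sup>+x. ennreal (jump_density \<kappa> q (x - z)) \<partial>lborel) = 1" for z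
    using nn_integral_real_affine[of "\<lambda>x. ennreal (jump_density \<kappa> q x)" 1 "- z"] jump_density_mass
    by simp
  \<comment> \<open>Convolution with a probability density preserves the L1 norm of a nonnegative
    function.\<close>
  have \<Phi>_mass: "(\<integral>\<^sup>+x. \<Phi> x s \<partial>lborel) = m s" for s
  proof -
    have "(\<integral>\<^sup>+x. \<Phi> x s \<partial>lborel) = (\<integral>\<^sup>+z. \<integral>\<^sup>+x. ennreal \<bar>v (z, s)\<bar> * ennreal (jump_density \<kappa> q (x - z)) \<partial>lborel \<partial>lborel)"
      unfolding \<Phi>_def by (rule lborel_pair.Fubini') measurable
    also have "\<dots> = m s"
      unfolding m_def by (intro nn_integral_cong) (simp add: nn_integral_cmult mass)
    finally show ?thesis .
  qed
  have u_le: "ennreal \<bar>u x t\<bar> \<le> (\<integral>\<^sup>+s. \<Phi> x s * indicator {0..t} s \<partial>lborel)"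
    if x: "x \<in> {0<..R}" and t: "t \<in> {0..T}" for x t
  proof (rule abs_le_nn_integral_deriv_bound)
    show "0 \<le> t" using t by simp
    show "u x 0 = 0" using is_solutionD(3)[OF f, of x] is_solutionD(3)[OF g, of x] x by (simp add: u_def)
    fix s assume s: "s \<in> {0..t}"
    have s0: "0 \<le> s" and x0: "0 < x" using s x by auto
    let ?F = "exp (- s - \<kappa> * x) * (LBINT \<rho>:{0<..<1}. \<kappa> powr \<rho> * x powr (\<rho> - 1) / Gamma \<rho> * q \<rho>)"
    let ?Df = "conv_deriv \<kappa> q (\<lambda>z. f z s) x" and ?Dg = "conv_deriv \<kappa> q (\<lambda>z. g z s) x"
    let ?L = "(f x s - ?Df) - (g x s - ?Dg)"
    have df: "((\<lambda>s. f x s) has_real_derivative - ?Df + ?F) (at s within {0..t})"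
      "((\<lambda>s. g x s) has_real_derivative - ?Dg + ?F) (at s within {0..t})"
      by (rule has_field_derivative_subset[OF is_solutionD(5)[OF f x0 s0]], simp)
        (rule has_field_derivative_subset[OF is_solutionD(5)[OF g x0 s0]], simp)
    have "((\<lambda>s. exp s * (f x s - g x s)) has_real_derivative
        exp s * (f x s - g x s) + ((- ?Df + ?F) - (- ?Dg + ?F)) * exp s) (at s within {0..t})"
      by (intro DERIV_mult DERIV_exp[THEN has_field_derivative_at_within] DERIV_diff df)
    then show "((\<lambda>s. u x s) has_real_derivative exp s * ?L) (at s within {0..t})"
      unfolding u_def by (simp add: algebra_simps)
    have "ennreal \<bar>exp s * ?L\<bar> = ennreal (exp s) * ennreal \<bar>?L\<bar>"
      by (simp add: abs_mult ennreal_mult)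
    also have "\<dots> \<le> ennreal (exp s) * (\<integral>\<^sup>+z. ennreal \<bar>indicator {0<..x} z * (f z s - g z s)\<bar> * ennreal (jump_density \<kappa> q (x - z)) \<partial>lborel)"
      by (intro mult_left_mono conv_deriv_diff_le is_solutionD[OF f] is_solutionD[OF g] s0 x0) simp
    also have "\<dots> = (\<integral>\<^sup>+z. ennreal (exp s) * (ennreal \<bar>indicator {0<..x} z * (f z s - g z s)\<bar> * ennreal (jump_density \<kappa> q (x - z))) \<partial>lborel)"
    proof (rule nn_integral_cmult[symmetric])
      \<comment> \<open>Measurability of the difference at the fixed time s is read off from a
        section of the jointly measurable \<open>v\<close>.\<close>
      have "(\<lambda>z. indicator {0<..x} z * (exp (- s) * v (z, s))) \<in> borel_measurable lborel" by measurable
      moreover have "(\<lambda>z. indicator {0<..x} z * (exp (- s) * v (z, s))) = (\<lambda>z. indicator {0<..x} z * (f z s - g z s))"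
        using x s t by (auto simp: v_def u_def indicator_def exp_minus)
      ultimately have [measurable]: "(\<lambda>z. indicator {0<..x} z * (f z s - g z s)) \<in> borel_measurable lborel" by simp
      show "(\<lambda>z. ennreal \<bar>indicator {0<..x} z * (f z s - g z s)\<bar> * ennreal (jump_density \<kappa> q (x - z))) \<in> borel_measurable lborel"
        by measurable
    qed
    also have "\<dots> \<le> \<Phi> x s"
      unfolding \<Phi>_def
      using x s t by (intro nn_integral_mono)
        (auto simp: v_def u_def indicator_def abs_mult ennreal_mult mult.assoc)
    finally show "ennreal \<bar>exp s * ?L\<bar> \<le> \<Phi> x s" .
  qed measurable
  have m_le: "m t \<le> (\<integral>\<^sup>+s. m s * indicator {0..t} s \<partial>lborel)" for t
  proof (cases "t \<in> {0..T}")
    case True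
    have "m t \<le> (\<integral>\<^sup>+x. \<integral>\<^sup>+s. \<Phi> x s * indicator {0..t} s \<partial>lborel \<partial>lborel)"
      unfolding m_def
    proof (rule nn_integral_mono)
      fix x
      show "ennreal \<bar>v (x, t)\<bar> \<le> (\<integral>\<^sup>+s. \<Phi> x s * indicator {0..t} s \<partial>lborel)"
        using u_le[of x t] True by (cases "x \<in> {0<..R}") (auto simp: v_def)
    qed
    also have "\<dots> = (\<integral>\<^sup>+s. \<integral>\<^sup>+x. \<Phi> x s * indicator {0..t} s \<partial>lborel \<partial>lborel)"
    proof (rule lborel_pair.Fubini')
      have "(\<lambda>p. \<Phi> (snd p) (fst p) * indicator {0..t} (fst p)) \<in> borel_measurable (lborel \<Otimes>\<^sub>M lborel)"
        by measurable
      then show "case_prod (\<lambda>s x. \<Phi> x s * indicator {0..t} s) \<in> borel_measurable (lborel \<Otimes>\<^sub>M lborel)"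
        by (simp add: case_prod_beta')
    qed
    also have "\<dots> = (\<integral>\<^sup>+s. m s * indicator {0..t} s \<partial>lborel)"
    proof (intro nn_integral_cong)
      fix s
      have "(\<lambda>x. \<Phi> x s) \<in> borel_measurable lborel"
        unfolding \<Phi>_def by measurable
      then show "(\<integral>\<^sup>+x. \<Phi> x s * indicator {0..t} s \<partial>lborel) = m s * indicator {0..t} s"
        by (simp add: nn_integral_multc \<Phi>_mass)
    qed
    finally show ?thesis .
  next
    case False
    then have "v (z, t) = 0" for z by (auto simp: v_def indicator_def)
    then have "m t = 0" by (simp add: m_def)
    then show ?thesis by simp
  qed
  have m0: "m s = 0" if "0 \<le> s" for s
    by (rule integral_gronwall_zero[OF m_meas m_fin m_le that])
  \<comment> \<open>Here m s = 0 gives \<open>v\<close> = 0 almost everywhere in z, which suffices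
    for the convolution to vanish at every x; \<open>u_le\<close> then yields u = 0 at the given
    point itself.\<close>
  have "\<Phi> x s = 0" if "0 \<le> s" for x s
  proof -
    have "AE z in lborel. ennreal \<bar>v (z, s)\<bar> = 0"
      using m0[OF that] unfolding m_def by (subst (asm) nn_integral_0_iff_AE) auto
    then have "\<Phi> x s = (\<integral>\<^sup>+z. 0 \<partial>(lborel :: real measure))"
      unfolding \<Phi>_def by (intro nn_integral_cong_AE, eventually_elim) simp
    then show ?thesis by simp
  qed
  then have "(\<integral>\<^sup>+s. \<Phi> x0 s * indicator {0..t0} s \<partial>lborel) = (\<integral>\<^sup>+s. 0 \<partial>(lborel :: real measure))"
    by (intro nn_integral_cong) (auto simp: indicator_def)
  then have "ennreal \<bar>u x0 t0\<bar> = 0"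
    using u_le[of x0 t0] x0 t0 by (simp add: R_def T_def)
  then show ?thesis by (simp add: u_def)
qed

end

theorem theorem14:
  fixes \<alpha> :: real and k :: "real \<Rightarrow> real" and q :: "real \<Rightarrow> real"
    and P :: "'b measure" and \<rho> :: "'b \<Rightarrow> real"
    and M :: "'a measure" and N :: "real \<Rightarrow> 'a \<Rightarrow> nat" and X :: "nat \<Rightarrow> 'a \<Rightarrow> real"
  assumes "0 < \<alpha>" and "\<alpha> < 1" and "0 < k \<alpha>"
    and "prob_space P"
    and "\<And>r. 0 \<le> q r"
    and "distributed P lborel \<rho> (\<lambda>r. ennreal (q r))"
    and "AE \<omega> in P. \<rho> \<omega> \<in> {0<..<1}"
    and "prob_space M"
    and "poisson_process M 1 N"
    and "prob_space.indep_vars M (\<lambda>_. borel) X {1..}"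
    and "\<And>j. 1 \<le> j \<Longrightarrow>
           distributed M lborel (X j) (\<lambda>x. ennreal (jump_density (k \<alpha>) q x))"
    and "prob_space.indep_set M
           (sets (vimage_algebra (space M) (\<lambda>\<omega>. \<lambda>t\<in>{0..}. N t \<omega>)
              (PiM {0..} (\<lambda>_. count_space UNIV))))
           (sets (vimage_algebra (space M) (\<lambda>\<omega>. \<lambda>j\<in>{1..}. X j \<omega>)
              (PiM {1..} (\<lambda>_. borel))))"
  shows "ac_component_density M (compound_sum N X) (compound_density (jump_density (k \<alpha>) q))
    \<and> is_solution (k \<alpha>) q (compound_density (jump_density (k \<alpha>) q))
    \<and> (\<forall>g. is_solution (k \<alpha>) q g \<longrightarrow>
          (\<forall>x>0. \<forall>t\<ge>0. g x t = compound_density (jump_density (k \<alpha>) q) x t))"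
proof -
  interpret P: prob_space P by fact
  have q_meas: "(\<lambda>r. ennreal (q r)) \<in> borel_measurable borel"
    using distributed_borel_measurable[OF assms(6)] by simp
  interpret shape_mixture "k \<alpha>" q
  proof
    have "(\<lambda>r. enn2real (ennreal (q r))) \<in> borel_measurable borel"
      using q_meas by measurable
    then show "q \<in> borel_measurable borel" using assms(5) by simp
    \<comment> \<open>The mass of q on (0, 1) is the probability that \<rho> lies there, which is 1
      by assumption.\<close>
    have "(\<integral>\<^sup>+r. ennreal (q r) * indicator {0<..<1} r \<partial>lborel) = emeasure P (\<rho> -` {0<..<1} \<inter> space P)"
      using assms(6) by (intro distributed_emeasure[symmetric]) auto
    also have "\<dots> = emeasure P (space P)"
    proof (rule emeasure_eq_AE)
      show "AE \<omega> in P. (\<omega> \<in> \<rho> -` {0<..<1} \<inter> space P) = (\<omega> \<in> space P)"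
        using assms(7) by eventually_elim auto
      show "\<rho> -` {0<..<1} \<inter> space P \<in> sets P"
        using distributed_measurable[OF assms(6)] by (auto intro: measurable_sets)
    qed simp
    finally show "(\<integral>\<^sup>+r. ennreal (q r) * indicator {0<..<1} r \<partial>lborel) = 1"
      by (simp add: P.emeasure_space_1)
  qed (use assms(3,5) in auto)
  show ?thesis
    using ac_component_density_cdens[OF assms(8,9,10,11,12)] is_solution_cdens
      solution_unique[OF _ is_solution_cdens]
    by blast
qed

end
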